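(* For any two words $w_1,w_2$ in $\mathcal B_n^*$ (resp. in $\mathcal D_n^*$), $w_1$ and $w_2$ lie in the same connected component of $G_n^B$ (resp. $G_n^D$) if and only if $Q^B(w_1)=Q^B(w_2)$ (resp. $Q^D(w_1)=Q^D(w_2)$).
   Context: Fix $n\ge2$. Alphabets $\mathcal B_n=\{1\prec\cdots\prec n\prec0\prec\bar n\prec\cdots\prec\bar1\}$, $\mathcal D_n=\{1\prec\cdots\prec n-1\prec n,\bar n\prec\overline{n-1}\prec\cdots\prec\bar1\}$ ($n,\bar n$ incomparable). Vector crystals: $\mathcal B_n$: arrows $i\xrightarrow{i}i+1$, $\overline{i+1}\xrightarrow{i}\bar i$ ($i<n$), $n\xrightarrow{n}0\xrightarrow{n}\bar n$; $\mathcal D_n$: $i\xrightarrow{i}i+1$, $\overline{i+1}\xrightarrow{i}\bar i$ ($i<n$), $n-1\xrightarrow{n}\bar n$, $n\xrightarrow{n}\overline{n-1}$. Tensor rule: $\tilde f_i(u\otimes v)=\tilde f_iu\otimes v$ if $\varphi_i(u)>\varepsilon_i(v)$, else $u\otimes\tilde f_iv$; $\tilde e_i(u\otimes v)=u\otimes\tilde e_iv$ if $\varphi_i(u)<\varepsilon_i(v)$, else $\tilde e_iu\otimes v$; words identified with tensors, giving $G_n^B$, $G_n^D$. $w_1\sim w_2$: same position ($w_j=\tilde f_{i_1}\cdots\tilde f_{i_r}w_j^0$) in isomorphic components with highest weight vertices $w_j^0$. Columns of type $B$: letters of $\mathcal B_n$ strictly increasing top to bottom except $0$ may repeat; type $D$: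 letters $x_1..x_l$ of $\mathcal D_n$ with $x_{i+1}\not\preceq x_i$. Tabloid $T=C_1\cdots C_r$, $h(C_1)\ge\cdots\ge h(C_r)$, diagram $Y$, reading $\mathrm w(C_r)\cdots\mathrm w(C_1)$. $T_Y$: columns of height $k$ filled $1,\dots,k$; $T_Y^-$: same but height-$n$ columns filled $1,\dots,n-1,\bar n$. Type $B$ orthogonal tableau of shape $Y$: $\mathrm w(T)$ in the component of $\mathrm w(T_Y)$. Type $D$: $\mathrm w(T)$ in the component of $\mathrm w(T_Y)$ (shape $(Y,+)$, or $(Y,0)$ if $Y$ has no height-$n$ column) or of $\mathrm w(T_Y^-)$ (shape $(Y,-)$). $P(w)$ is the unique orthogonal tableau with $\mathrm w(P(w))\sim w$; for $w=x_1\cdots x_l$, $Q^B(w)$ (resp. $Q^D(w)$) is the sequence of shapes of $P(x_1),P(x_1x_2),\dots,P(x_1\cdots x_l)$. *)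

theory Defs
  imports Main
begin

datatype letter = Pos nat | Zero | Bar nat

datatype ctype = TypeB | TypeD

definition alphB :: "nat \<Rightarrow> letter set" where
  "alphB n = {Pos i | i. 1 \<le> i \<and> i \<le> n} \<union> {Zero} \<union> {Bar i | i. 1 \<le> i \<and> i \<le> n}"

definition alphD :: "nat \<Rightarrow> letter set" where
  "alphD n = {Pos i | i. 1 \<le> i \<and> i \<le> n} \<union> {Bar i | i. 1 \<le> i \<and> i \<le> n}"

fun precB :: "nat \<Rightarrow> letter \<Rightarrow> letter \<Rightarrow> bool" where
  "precB n (Pos i) (Pos j) = (i < j)"
| "precB n (Pos i) Zero = True"
| "precB n (Pos i) (Bar j) = True"
| "precB n Zero (Bar j) = True"
| "precB n (Bar i) (Bar j) = (j < i)"
| "precB n _ _ = False"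

fun precD :: "nat \<Rightarrow> letter \<Rightarrow> letter \<Rightarrow> bool" where
  "precD n (Pos i) (Pos j) = (i < j)"
| "precD n (Pos i) (Bar j) = (\<not> (i = n \<and> j = n))"
| "precD n (Bar i) (Bar j) = (j < i)"
| "precD n _ _ = False"

definition preceqD :: "nat \<Rightarrow> letter \<Rightarrow> letter \<Rightarrow> bool" where
  "preceqD n x y \<longleftrightarrow> x = y \<or> precD n x y"

text \<open>Kashiwara operators on single letters (None stands for 0).\<close>
fun fL :: "ctype \<Rightarrow> nat \<Rightarrow> nat \<Rightarrow> letter \<Rightarrow> letter option" where
  "fL t n i (Pos j) =
     (if 1 \<le> i \<and> i < n \<and> j = i then Some (Pos (i+1))
      else if i = n \<and> t = TypeB \<and> j = n then Some Zero
      else if i = n \<and> t = TypeD \<and> j = n - 1 then Some (Bar n)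
      else if i = n \<and> t = TypeD \<and> j = n then Some (Bar (n - 1))
      else None)"
| "fL t n i Zero = (if i = n \<and> t = TypeB then Some (Bar n) else None)"
| "fL t n i (Bar j) = (if 1 \<le> i \<and> i < n \<and> j = i + 1 then Some (Bar i) else None)"

fun eL :: "ctype \<Rightarrow> nat \<Rightarrow> nat \<Rightarrow> letter \<Rightarrow> letter option" where
  "eL t n i (Pos j) = (if 1 \<le> i \<and> i < n \<and> j = i + 1 then Some (Pos i) else None)"
| "eL t n i Zero = (if i = n \<and> t = TypeB then Some (Pos n) else None)"
| "eL t n i (Bar j) =
     (if 1 \<le> i \<and> i < n \<and> j = i then Some (Bar (i+1))
      else if i = n \<and> t = TypeB \<and> j = n then Some Zero
      else if i = n \<and> t = TypeD \<and> j = n then Some (Pos (n - 1))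
      else if i = n \<and> t = TypeD \<and> j = n - 1 then Some (Pos n)
      else None)"

definition opow :: "('a \<Rightarrow> 'a option) \<Rightarrow> nat \<Rightarrow> 'a \<Rightarrow> 'a option" where
  "opow g k x = ((\<lambda>r. Option.bind r g) ^^ k) (Some x)"

definition phiL :: "ctype \<Rightarrow> nat \<Rightarrow> nat \<Rightarrow> letter \<Rightarrow> nat" where
  "phiL t n i x = card {k. 0 < k \<and> opow (fL t n i) k x \<noteq> None}"

definition epsL :: "ctype \<Rightarrow> nat \<Rightarrow> nat \<Rightarrow> letter \<Rightarrow> nat" where
  "epsL t n i x = card {k. 0 < k \<and> opow (eL t n i) k x \<noteq> None}"

text \<open>phi and epsilon of a tensor product u \<otimes> v (u a letter, v a word), following the tensor
  product rule: eps(u \<otimes> v) = eps u + max 0 (eps v - phi u),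
  phi(u \<otimes> v) = phi v + max 0 (phi u - eps v).\<close>
fun epsW :: "ctype \<Rightarrow> nat \<Rightarrow> nat \<Rightarrow> letter list \<Rightarrow> nat"
and phiW :: "ctype \<Rightarrow> nat \<Rightarrow> nat \<Rightarrow> letter list \<Rightarrow> nat" where
  "epsW t n i [] = 0"
| "epsW t n i (x # v) = epsL t n i x + (epsW t n i v - phiL t n i x)"
| "phiW t n i [] = 0"
| "phiW t n i (x # v) = phiW t n i v + (phiL t n i x - epsW t n i v)"

fun fW :: "ctype \<Rightarrow> nat \<Rightarrow> nat \<Rightarrow> letter list \<Rightarrow> letter list option" where
  "fW t n i [] = None"
| "fW t n i (x # v) =
     (if phiL t n i x > epsW t n i v then map_option (\<lambda>y. y # v) (fL t n i x)
      else map_option (\<lambda>v'. x # v') (fW t n i v))"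

fun eW :: "ctype \<Rightarrow> nat \<Rightarrow> nat \<Rightarrow> letter list \<Rightarrow> letter list option" where
  "eW t n i [] = None"
| "eW t n i (x # v) =
     (if phiL t n i x < epsW t n i v then map_option (\<lambda>v'. x # v') (eW t n i v)
      else map_option (\<lambda>y. y # v) (eL t n i x))"

definition edges :: "ctype \<Rightarrow> nat \<Rightarrow> (letter list \<times> letter list) set" where
  "edges t n = {(a, b). \<exists>i\<in>{1..n}. fW t n i a = Some b}"

definition comp :: "ctype \<Rightarrow> nat \<Rightarrow> letter list \<Rightarrow> letter list set" where
  "comp t n w = {w'. (w, w') \<in> (edges t n \<union> (edges t n)\<inverse>)\<^sup>*}"

definition highest :: "ctype \<Rightarrow> nat \<Rightarrow> letter list \<Rightarrow> bool" where
  "highest t n w \<longleftrightarrow> (\<forall>i\<in>{1..n}. eW t n i w = None)"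

definition comp_iso :: "ctype \<Rightarrow> nat \<Rightarrow> (letter list \<Rightarrow> letter list) \<Rightarrow> letter list \<Rightarrow> letter list \<Rightarrow> bool" where
  "comp_iso t n g h1 h2 \<longleftrightarrow> bij_betw g (comp t n h1) (comp t n h2) \<and>
     (\<forall>x\<in>comp t n h1. \<forall>i\<in>{1..n}. map_option g (fW t n i x) = fW t n i (g x))"

fun fseq :: "ctype \<Rightarrow> nat \<Rightarrow> nat list \<Rightarrow> letter list \<Rightarrow> letter list option" where
  "fseq t n [] w = Some w"
| "fseq t n (i # is) w = Option.bind (fseq t n is w) (fW t n i)"

definition csim :: "ctype \<Rightarrow> nat \<Rightarrow> letter list \<Rightarrow> letter list \<Rightarrow> bool" where
  "csim t n w1 w2 \<longleftrightarrow> (\<exists>h1 h2 g is. highest t n h1 \<and> highest t n h2 \<and>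
     comp_iso t n g h1 h2 \<and> g h1 = h2 \<and> set is \<subseteq> {1..n} \<and>
     fseq t n is h1 = Some w1 \<and> fseq t n is h2 = Some w2)"

text \<open>A column is the list of its letters read from top to bottom; this is its reading word.\<close>
definition colB :: "nat \<Rightarrow> letter list \<Rightarrow> bool" where
  "colB n C \<longleftrightarrow> set C \<subseteq> alphB n \<and> successively (\<lambda>x y. precB n x y \<or> (x = Zero \<and> y = Zero)) C"

definition colD :: "nat \<Rightarrow> letter list \<Rightarrow> bool" where
  "colD n C \<longleftrightarrow> set C \<subseteq> alphD n \<and> successively (\<lambda>x y. \<not> preceqD n y x) C"

text \<open>A tabloid is a list of columns C1 ... Cr; its shape is the list of heights.\<close>
definition readT :: "letter list list \<Rightarrow> letter list" where
  "readT T = concat (rev T)"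

definition valid_shape :: "nat \<Rightarrow> nat list \<Rightarrow> bool" where
  "valid_shape n Y \<longleftrightarrow> sorted_wrt (\<ge>) Y \<and> (\<forall>k\<in>set Y. 0 < k \<and> k \<le> n)"

definition TY :: "nat list \<Rightarrow> letter list list" where
  "TY Y = map (\<lambda>k. map Pos [1..<k+1]) Y"

definition TYm :: "nat \<Rightarrow> nat list \<Rightarrow> letter list list" where
  "TYm n Y = map (\<lambda>k. if k = n then map Pos [1..<n] @ [Bar n] else map Pos [1..<k+1]) Y"

definition orthB :: "nat \<Rightarrow> nat list \<Rightarrow> letter list list \<Rightarrow> bool" where
  "orthB n Y T \<longleftrightarrow> valid_shape n Y \<and> map length T = Y \<and> (\<forall>C\<in>set T. colB n C) \<and>
     readT T \<in> comp TypeB n (readT (TY Y))"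

datatype dsign = DPlus | DMinus | DZero

definition orthD :: "nat \<Rightarrow> nat list \<times> dsign \<Rightarrow> letter list list \<Rightarrow> bool" where
  "orthD n S T \<longleftrightarrow> (let Y = fst S in
     valid_shape n Y \<and> map length T = Y \<and> (\<forall>C\<in>set T. colD n C) \<and>
     (case snd S of
        DPlus \<Rightarrow> n \<in> set Y \<and> readT T \<in> comp TypeD n (readT (TY Y))
      | DMinus \<Rightarrow> n \<in> set Y \<and> readT T \<in> comp TypeD n (readT (TYm n Y))
      | DZero \<Rightarrow> n \<notin> set Y \<and> readT T \<in> comp TypeD n (readT (TY Y))))"

definition PB :: "nat \<Rightarrow> letter list \<Rightarrow> letter list list" where
  "PB n w = (THE T. (\<exists>Y. orthB n Y T) \<and> csim TypeB n (readT T) w)"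

definition PD :: "nat \<Rightarrow> letter list \<Rightarrow> letter list list" where
  "PD n w = (THE T. (\<exists>S. orthD n S T) \<and> csim TypeD n (readT T) w)"

definition shapeD :: "nat \<Rightarrow> letter list list \<Rightarrow> nat list \<times> dsign" where
  "shapeD n T = (THE S. orthD n S T)"

definition QB :: "nat \<Rightarrow> letter list \<Rightarrow> nat list list" where
  "QB n w = map (\<lambda>k. map length (PB n (take k w))) [1..<length w + 1]"

definition QD :: "nat \<Rightarrow> letter list \<Rightarrow> (nat list \<times> dsign) list" where
  "QD n w = map (\<lambda>k. shapeD n (PD n (take k w))) [1..<length w + 1]"

end

theory Submission
  imports Defs "HOL-Library.Multiset"
begin

text \<open>For each pair of nodes of the Dynkin diagram of \<open>D\<^sub>n\<close> a word is reduced to an explicit rank-two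
  tableau, which carries all rank-two information. Hence two connected vertices that are highest
  for a pair of nodes coincide, and this local confluence shows by induction on the height that
  following the same lowering paths from two highest words of equal weight is a well-defined
  isomorphism of their components, with only one highest word in each. Type \<open>B\<^sub>n\<close> is deduced from
  \<open>D\<^sub>n\<^sub>+\<^sub>1\<close> by replacing every letter by two letters, which folds the diagram. So \<open>P\<close> is well defined
  and the shape of \<open>P(w)\<close> records the weight of the highest word of the component of \<open>w\<close>.
  Operators act on a prefix as on a word, so \<open>Q\<close> is constant on components. Conversely, if the
  prefixes of length \<open>l - 1\<close> lie in one component, the highest words of the full words share their
  first \<open>l - 1\<close> letters, and since all letters have different weights the last shape determines
  the last letter.\<close>

section \<open>Letters and words\<close>

text \<open>All roots of D_n have the same length, so two nodes generate a crystal of type A_2 or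
  A_1 x A_1, and there a tableau, or merely the string lengths, is a complete invariant. The
  obstacle is well-definedness: two lowering paths may end in the same vertex of one component but,
  a priori, in different vertices of the other. If the paths end with different arrows i and j, the
  {i, j}-component of the common vertex has a single highest vertex, which lies higher up, where the
  induction already controls everything. The uniqueness of the highest vertex, usually taken from
  representation theory, then follows by comparing a component with itself.\<close>

lemma opow_Suc: "opow g (Suc k) x = Option.bind (g x) (opow g k)"
proof -
  have "opow g (Suc k) x = ((\<lambda>r. Option.bind r g) ^^ k) (g x)"
    unfolding opow_def by (simp add: funpow_Suc_right del: funpow.simps)
  moreover have "((\<lambda>r. Option.bind r g) ^^ k) None = None"
    by (induction k) auto
  ultimately show ?thesis by (cases "g x") (auto simp: opow_def)
qed

lemma opow_0 [simp]: "opow g 0 x = Some x"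
  by (simp add: opow_def)

lemma card_opow_None: "g x = None \<Longrightarrow> card {k. 0 < k \<and> opow g k x \<noteq> None} = 0"
proof -
  assume "g x = None"
  then have "{k. 0 < k \<and> opow g k x \<noteq> None} = {}"
    by (auto simp: gr0_conv_Suc opow_Suc)
  then show ?thesis by (simp only: card.empty)
qed

text \<open>The second hypothesis makes the chain stop and hence the counted set finite;
  \<open>card\<close> of an infinite set would be 0.\<close>

lemma card_opow_Some:
  assumes "g x = Some y" and "opow g m y = None"
  shows "card {k. 0 < k \<and> opow g k x \<noteq> None} = Suc (card {k. 0 < k \<and> opow g k y \<noteq> None})"
proof -
  let ?S = "{k. 0 < k \<and> opow g k y \<noteq> None}"
  have None: "opow g (m + k) y = None" for k
    using assms(2) by (induction k) (auto simp: opow_def)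
  have "?S \<subseteq> {..<m}"
    using None by (metis (mono_tags, lifting) lessThan_iff mem_Collect_eq not_less le_Suc_ex subsetI)
  then have fin: "finite ?S" using finite_subset by blast
  have "{k. 0 < k \<and> opow g k x \<noteq> None} = Suc ` insert 0 ?S"
    using assms(1) by (auto simp: gr0_conv_Suc opow_Suc image_iff)
  then have "card {k. 0 < k \<and> opow g k x \<noteq> None} = card (insert 0 ?S)"
    by (simp only: card_image[OF inj_Suc])
  then show ?thesis
    using fin by simp
qed

text \<open>The longest string of letters has two arrows, from \<open>Pos n\<close> through
  \<open>Zero\<close> to \<open>Bar n\<close> in type B, so two further steps after a first one
  always fail.\<close>

lemma fL_chain: "2 \<le> n \<Longrightarrow> fL t n i x = Some y \<Longrightarrow> opow (fL t n i) 2 y = None"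
  by (cases x) (auto simp: numeral_2_eq_2 opow_Suc split: if_splits)

lemma eL_chain: "2 \<le> n \<Longrightarrow> eL t n i x = Some y \<Longrightarrow> opow (eL t n i) 2 y = None"
  by (cases x) (auto simp: numeral_2_eq_2 opow_Suc split: if_splits)

lemma phiL_rec:
  "2 \<le> n \<Longrightarrow> phiL t n i x = (case fL t n i x of None \<Rightarrow> 0 | Some y \<Rightarrow> Suc (phiL t n i y))"
  unfolding phiL_def
  using card_opow_None[of "fL t n i" x] card_opow_Some[of "fL t n i" x, OF _ fL_chain]
  by (cases "fL t n i x") (simp_all only: option.case)

lemma epsL_rec:
  "2 \<le> n \<Longrightarrow> epsL t n i x = (case eL t n i x of None \<Rightarrow> 0 | Some y \<Rightarrow> Suc (epsL t n i y))"
  unfolding epsL_def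
  using card_opow_None[of "eL t n i" x] card_opow_Some[of "eL t n i" x, OF _ eL_chain]
  by (cases "eL t n i x") (simp_all only: option.case)

lemma phiL_simps:
  assumes "2 \<le> n"
  shows "phiL t n i (Pos j) =
      (if 1 \<le> i \<and> i < n \<and> j = i then 1
       else if i = n \<and> t = TypeB \<and> j = n then 2
       else if i = n \<and> t = TypeD \<and> (j = n - 1 \<or> j = n) then 1 else 0)"
    and "phiL t n i Zero = (if i = n \<and> t = TypeB then 1 else 0)"
    and "phiL t n i (Bar j) = (if 1 \<le> i \<and> i < n \<and> j = i + 1 then 1 else 0)"
proof -
  show Bar: "phiL t n i (Bar j) = (if 1 \<le> i \<and> i < n \<and> j = i + 1 then 1 else 0)" for j
    using assms by (subst phiL_rec[OF assms]) (auto simp: phiL_rec[OF assms, of t i "Bar i"])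
  have Bar_n: "phiL t n n (Bar j) = 0" for t j
    by (subst phiL_rec[OF assms]) auto
  show Zero: "phiL t n i Zero = (if i = n \<and> t = TypeB then 1 else 0)" for t i
    using assms by (subst phiL_rec[OF assms]) (auto simp: Bar_n)
  have Pos: "i < n \<Longrightarrow> phiL t n i (Pos (Suc i)) = 0"
    by (subst phiL_rec[OF assms]) auto
  show "phiL t n i (Pos j) =
      (if 1 \<le> i \<and> i < n \<and> j = i then 1
       else if i = n \<and> t = TypeB \<and> j = n then 2
       else if i = n \<and> t = TypeD \<and> (j = n - 1 \<or> j = n) then 1 else 0)"
    using assms by (subst phiL_rec[OF assms]) (auto simp: Bar_n Zero Pos)
qed

lemma epsL_simps:
  assumes "2 \<le> n"
  shows "epsL t n i (Pos j) = (if 1 \<le> i \<and> i < n \<and> j = i + 1 then 1 else 0)"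
    and "epsL t n i Zero = (if i = n \<and> t = TypeB then 1 else 0)"
    and "epsL t n i (Bar j) =
      (if 1 \<le> i \<and> i < n \<and> j = i then 1
       else if i = n \<and> t = TypeB \<and> j = n then 2
       else if i = n \<and> t = TypeD \<and> (j = n - 1 \<or> j = n) then 1 else 0)"
proof -
  show Pos: "epsL t n i (Pos j) = (if 1 \<le> i \<and> i < n \<and> j = i + 1 then 1 else 0)" for j
    using assms by (subst epsL_rec[OF assms]) (auto simp: epsL_rec[OF assms, of t i "Pos i"])
  have Pos_n: "epsL t n n (Pos j) = 0" for t j
    by (subst epsL_rec[OF assms]) auto
  show Zero: "epsL t n i Zero = (if i = n \<and> t = TypeB then 1 else 0)" for t i
    using assms by (subst epsL_rec[OF assms]) (auto simp: Pos_n)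
  have Bar: "i < n \<Longrightarrow> epsL t n i (Bar (Suc i)) = 0"
    by (subst epsL_rec[OF assms]) auto
  show "epsL t n i (Bar j) =
      (if 1 \<le> i \<and> i < n \<and> j = i then 1
       else if i = n \<and> t = TypeB \<and> j = n then 2
       else if i = n \<and> t = TypeD \<and> (j = n - 1 \<or> j = n) then 1 else 0)"
  proof (cases "i = n")
    case True
    then show ?thesis
      using assms by (subst epsL_rec[OF assms]) (cases t; auto simp: Zero Pos_n)
  next
    case False
    then show ?thesis
      by (subst epsL_rec[OF assms]) (auto simp: Bar)
  qed
qed

lemma fL_eq_Some_iff: "2 \<le> n \<Longrightarrow> fL t n i x = Some y \<longleftrightarrow> eL t n i y = Some x"
  by (cases x; cases y) (auto split: if_splits)

lemma fL_eq_None_iff: "2 \<le> n \<Longrightarrow> fL t n i x = None \<longleftrightarrow> phiL t n i x = 0"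
  by (auto simp: phiL_rec split: option.splits)

lemma eL_eq_None_iff: "2 \<le> n \<Longrightarrow> eL t n i x = None \<longleftrightarrow> epsL t n i x = 0"
  by (auto simp: epsL_rec split: option.splits)

lemma fL_Some_phiL: "2 \<le> n \<Longrightarrow> fL t n i x = Some y \<Longrightarrow> phiL t n i x = Suc (phiL t n i y)"
  by (simp add: phiL_rec[of n t i x])

lemma fL_Some_epsL: "2 \<le> n \<Longrightarrow> fL t n i x = Some y \<Longrightarrow> epsL t n i y = Suc (epsL t n i x)"
  by (simp add: fL_eq_Some_iff epsL_rec[of n t i y])

section \<open>The tensor product rule for arbitrary factors\<close>

lemma epsW_append: "epsW t n i (u @ v) = epsW t n i u + (epsW t n i v - phiW t n i u)"
  and phiW_append: "phiW t n i (u @ v) = phiW t n i v + (phiW t n i u - epsW t n i v)"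
proof -
  have "epsW t n i (u @ v) = epsW t n i u + (epsW t n i v - phiW t n i u) \<and>
    phiW t n i (u @ v) = phiW t n i v + (phiW t n i u - epsW t n i v)"
    by (induction u) auto
  then show "epsW t n i (u @ v) = epsW t n i u + (epsW t n i v - phiW t n i u)"
    and "phiW t n i (u @ v) = phiW t n i v + (phiW t n i u - epsW t n i v)" by auto
qed

text \<open>Associativity of the tensor rule: the definition splits off a single letter, while
  prefixes and columns require a cut at any position. An operator always acts inside exactly one of
  the two parts.\<close>

lemma fW_append:
  "fW t n i (u @ v) = (if phiW t n i u > epsW t n i v then map_option (\<lambda>u'. u' @ v) (fW t n i u)
     else map_option (\<lambda>v'. u @ v') (fW t n i v))"
proof (induction u)
  case Nil
  then show ?case by (cases "fW t n i v") simp_all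
next
  case (Cons x u)
  show ?case
  proof (cases "phiL t n i x > epsW t n i (u @ v)")
    case True
    moreover from True have "phiL t n i x > epsW t n i u" "phiW t n i (x # u) > epsW t n i v"
      by (auto simp: epsW_append)
    ultimately show ?thesis by (simp add: option.map_comp o_def)
  next
    case False
    then have "phiW t n i (x # u) > epsW t n i v \<longleftrightarrow> phiW t n i u > epsW t n i v"
      "phiW t n i u > epsW t n i v \<Longrightarrow> \<not> phiL t n i x > epsW t n i u"
      by (auto simp: epsW_append)
    with False Cons show ?thesis by (simp add: option.map_comp o_def)
  qed
qed

lemma fW_eq_None_iff: "2 \<le> n \<Longrightarrow> fW t n i w = None \<longleftrightarrow> phiW t n i w = 0"
  by (induction w) (auto simp: fL_eq_None_iff)

lemma eW_eq_None_iff: "2 \<le> n \<Longrightarrow> eW t n i w = None \<longleftrightarrow> epsW t n i w = 0"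
  by (induction w) (auto simp: eL_eq_None_iff)

lemma fW_Some_phiW_epsW:
  assumes "2 \<le> n"
  shows "fW t n i w = Some w' \<Longrightarrow>
    phiW t n i w = Suc (phiW t n i w') \<and> epsW t n i w' = Suc (epsW t n i w)"
proof (induction w arbitrary: w')
  case (Cons x v)
  show ?case
  proof (cases "phiL t n i x > epsW t n i v")
    case True
    with Cons.prems obtain y where y: "fL t n i x = Some y" "w' = y # v" by auto
    with True fL_Some_phiL[OF assms y(1)] fL_Some_epsL[OF assms y(1)] show ?thesis by auto
  next
    case False
    with Cons.prems obtain v' where v': "fW t n i v = Some v'" "w' = x # v'" by auto
    with False Cons.IH[OF v'(1)] show ?thesis by auto
  qed
qed simp

text \<open>The two tensor rules are compatible: if \<open>fW\<close> acts on the left because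
  \<phi> > \<epsilon>, then \<phi> drops by one and \<phi> \<ge> \<epsilon> sends \<open>eW\<close>
  to the left as well; if it acts on the right, \<epsilon> grows and \<phi> < \<epsilon> sends
  \<open>eW\<close> to the right.\<close>

lemma fW_eq_Some_iff:
  assumes "2 \<le> n"
  shows "fW t n i w = Some w' \<longleftrightarrow> eW t n i w' = Some w"
proof (induction w arbitrary: w')
  case Nil
  show ?case
  proof (cases w')
    case (Cons y v)
    then show ?thesis by auto
  qed simp
next
  case (Cons x v)
  show ?case
  proof
    assume L: "fW t n i (x # v) = Some w'"
    show "eW t n i w' = Some (x # v)"
    proof (cases "phiL t n i x > epsW t n i v")
      case True
      with L obtain y where y: "fL t n i x = Some y" "w' = y # v" by auto
      with True fL_Some_phiL[OF assms y(1)] show ?thesis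
        by (auto simp: fL_eq_Some_iff[OF assms])
    next
      case False
      with L obtain v' where v': "fW t n i v = Some v'" "w' = x # v'" by auto
      with False fW_Some_phiW_epsW[OF assms v'(1)] Cons.IH show ?thesis by auto
    qed
  next
    assume R: "eW t n i w' = Some (x # v)"
    then obtain y u where w': "w' = y # u" by (cases w') auto
    show "fW t n i (x # v) = Some w'"
    proof (cases "phiL t n i y < epsW t n i u")
      case True
      with R w' have u: "eW t n i u = Some v" "x = y" by auto
      then have "fW t n i v = Some u" using Cons.IH by simp
      with True fW_Some_phiW_epsW[OF assms this] w' u show ?thesis by auto
    next
      case False
      with R w' have "eL t n i y = Some x" "u = v" by auto
      then have y: "fL t n i x = Some y" by (simp add: fL_eq_Some_iff[OF assms])
      with False fL_Some_phiL[OF assms y] \<open>u = v\<close> w' show ?thesis by auto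
    qed
  qed
qed

lemma fW_length: "fW t n i w = Some w' \<Longrightarrow> length w' = length w"
  by (induction w arbitrary: w') (auto split: if_splits)


section \<open>Rank-two models\<close>

text \<open>The letters of a pair of adjacent nodes form the chains \<open>KA \<rightarrow> KB \<rightarrow> KC\<close> (vector representation of
  \<open>sl\<^sub>3\<close>) and \<open>KA' \<rightarrow> KB' \<rightarrow> KC'\<close> (its dual); \<open>True\<close> stands for the first node, \<open>False\<close> for the second.\<close>
datatype kind = KTriv | KA | KB | KC | KA' | KB' | KC'

text \<open>A pattern \<open>(p, a, b, q, c)\<close> is a semistandard tableau with first row \<open>1\<^sup>p 2\<^sup>a 3\<^sup>b\<close> and second row
  \<open>2\<^sup>q 3\<^sup>c\<close>, columns of height 3 being removed. Letters are inserted into the first row; a dual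
  letter is inserted as the column of height 2 it is isomorphic to.\<close>
type_synonym pattern = "nat \<times> nat \<times> nat \<times> nat \<times> nat"

fun kind_phi :: "bool \<Rightarrow> kind \<Rightarrow> nat" where
  "kind_phi s k = (if k \<in> (if s then {KA, KB'} else {KB, KA'}) then 1 else 0)"

fun kind_eps :: "bool \<Rightarrow> kind \<Rightarrow> nat" where
  "kind_eps s k = (if k \<in> (if s then {KB, KC'} else {KC, KB'}) then 1 else 0)"

fun kind_f :: "bool \<Rightarrow> kind \<Rightarrow> kind" where
  "kind_f True KA = KB"
| "kind_f True KB' = KC'"
| "kind_f False KB = KC"
| "kind_f False KA' = KB'"
| "kind_f _ k = k"

text \<open>Row insertion of 1 with bumping. If a bumped 2 in turn bumps a 3 out of the second row,
  a column 1 2 3 is completed and removed at once, so \<open>p\<close> and \<open>q\<close> keep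
  their values in that case.\<close>

fun ins1 :: "pattern \<Rightarrow> pattern" where
  "ins1 (p, a, b, q, c) =
     (if 0 < a then (if 0 < c then (p, a - 1, b, q, c - 1) else (p + 1, a - 1, b, q + 1, c))
      else if 0 < b then (p + 1, a, b - 1, q, c + 1) else (p + 1, a, b, q, c))"

fun ins2 :: "pattern \<Rightarrow> pattern" where
  "ins2 (p, a, b, q, c) = (if 0 < b then (p, a + 1, b - 1, q, c + 1) else (p, a + 1, b, q, c))"

fun ins3 :: "pattern \<Rightarrow> pattern" where
  "ins3 (p, a, b, q, c) = (p, a, b + 1, q, c)"

fun ins :: "kind \<Rightarrow> pattern \<Rightarrow> pattern" where
  "ins KTriv T = T"
| "ins KA T = ins1 T"
| "ins KB T = ins2 T"
| "ins KC T = ins3 T"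
| "ins KA' T = ins1 (ins2 T)"
| "ins KB' T = ins1 (ins3 T)"
| "ins KC' T = ins2 (ins3 T)"

text \<open>Column strictness: every 2 of the second row stands below a 1, and every 3 below a 1 or
  a 2.\<close>

fun pat_valid :: "pattern \<Rightarrow> bool" where
  "pat_valid (p, a, b, q, c) \<longleftrightarrow> q \<le> p \<and> q + c \<le> p + a"

text \<open>The signature rule: for the first node the 2s of the second row cancel 1s of the first
  row; for the second node the 3s of the second row cancel 2s of the first row. What remains
  uncancelled is counted here and in \<open>pat_phi\<close>.\<close>

fun pat_eps :: "bool \<Rightarrow> pattern \<Rightarrow> nat" where
  "pat_eps True (p, a, b, q, c) = a"
| "pat_eps False (p, a, b, q, c) = b + (c - a)"

fun pat_phi :: "bool \<Rightarrow> pattern \<Rightarrow> nat" where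
  "pat_phi True (p, a, b, q, c) = p - q"
| "pat_phi False (p, a, b, q, c) = q + (a - c)"

fun pat_f :: "bool \<Rightarrow> pattern \<Rightarrow> pattern" where
  "pat_f True (p, a, b, q, c) = (p - 1, a + 1, b, q, c)"
| "pat_f False (p, a, b, q, c) =
     (if c < a then (p, a - 1, b + 1, q, c) else (p, a, b, q - 1, c + 1))"

fun pat_e :: "bool \<Rightarrow> pattern \<Rightarrow> pattern" where
  "pat_e True (p, a, b, q, c) = (p + 1, a - 1, b, q, c)"
| "pat_e False (p, a, b, q, c) =
     (if a < c then (p, a, b, q + 1, c - 1) else (p, a + 1, b - 1, q, c))"

fun pat_shape :: "pattern \<Rightarrow> nat \<times> nat" where
  "pat_shape (p, a, b, q, c) = (p + a + b - (q + c), q + c)"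

lemma pat_valid_ins: "pat_valid T \<Longrightarrow> pat_valid (ins k T)"
  by (cases T; cases k) auto

text \<open>With the three lemmas that follow: inserting a letter into a tableau obeys the rule for
  tensoring with that letter on the left. A finite case analysis takes the place of the Knuth
  relations.\<close>

lemma pat_eps_ins:
  "pat_valid T \<Longrightarrow> pat_eps s (ins k T) = kind_eps s k + (pat_eps s T - kind_phi s k)"
  by (cases T; cases k; cases s) auto

lemma pat_phi_ins:
  "pat_valid T \<Longrightarrow> pat_phi s (ins k T) = pat_phi s T + (kind_phi s k - pat_eps s T)"
  by (cases T; cases k; cases s) auto

lemma pat_f_ins_left:
  "pat_valid T \<Longrightarrow> pat_eps s T < kind_phi s k \<Longrightarrow> pat_f s (ins k T) = ins (kind_f s k) T"
  by (cases T; cases k; cases s) auto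

lemma pat_f_ins_right:
  "pat_valid T \<Longrightarrow> \<not> pat_eps s T < kind_phi s k \<Longrightarrow> 0 < pat_phi s T \<Longrightarrow>
    pat_f s (ins k T) = ins k (pat_f s T)"
  by (cases T; cases k; cases s) (auto split: if_splits)

lemma pat_e_f: "pat_valid T \<Longrightarrow> 0 < pat_phi s T \<Longrightarrow> pat_e s (pat_f s T) = T"
  by (cases T; cases s) auto

lemma pat_shape_f: "pat_valid T \<Longrightarrow> 0 < pat_phi s T \<Longrightarrow> pat_shape (pat_f s T) = pat_shape T"
  by (cases T; cases s) auto

text \<open>In a highest tableau the first row contains only 1s and the second only 2s, so the shape
  and the two values of \<phi> carry the same information, and either of them fixes the
  tableau.\<close>

lemma pat_highest:
  assumes "pat_valid T" "\<And>s. pat_eps s T = 0"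
  shows "T = (pat_phi True T + pat_phi False T, 0, 0, pat_phi False T, 0)"
    and "pat_shape T = (pat_phi True T, pat_phi False T)"
  using assms(1) assms(2)[of True] assms(2)[of False] by (cases T; auto)+


text \<open>The Dynkin diagram is the chain 1, ..., n - 1 with the node n attached to n - 2. For n =
  2 the only two nodes are not adjacent, as D_2 is A_1 x A_1.\<close>

definition adjD :: "nat \<Rightarrow> nat \<Rightarrow> nat \<Rightarrow> bool" where
  "adjD n i j \<longleftrightarrow> (i < n \<and> j < n \<and> (j = i + 1 \<or> i = j + 1)) \<or> (i + 2 = n \<and> j = n) \<or> (j + 2 = n \<and> i = n)"

text \<open>In type D all strings of letters have length at most 1, so \<epsilon> and \<phi> at the
  two nodes already tell which vector of the sl_3 representation, of its dual, or of the trivial one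
  a letter is.\<close>

definition kind_of :: "nat \<Rightarrow> nat \<Rightarrow> nat \<Rightarrow> letter \<Rightarrow> kind" where
  "kind_of n i j x =
     (if phiL TypeD n i x = 1 then (if epsL TypeD n j x = 1 then KB' else KA)
      else if epsL TypeD n i x = 1 then (if phiL TypeD n j x = 1 then KB else KC')
      else if phiL TypeD n j x = 1 then KA'
      else if epsL TypeD n j x = 1 then KC else KTriv)"

lemma adjD_cases [consumes 3, case_names up down fork_left fork_right]:
  assumes "i \<in> {1..n}" "j \<in> {1..n}" "adjD n i j"
  obtains "1 \<le> i" "Suc i < n" "j = Suc i"
  | "1 \<le> j" "Suc j < n" "i = Suc j"
  | m where "n = Suc (Suc (Suc m))" "i = Suc m" "j = Suc (Suc (Suc m))"
  | m where "n = Suc (Suc (Suc m))" "j = Suc m" "i = Suc (Suc (Suc m))"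
proof -
  have "\<exists>m. n = Suc (Suc (Suc m)) \<and> k = Suc m" if "k \<in> {1..n}" "k + 2 = n" for k
    using that by (intro exI[of _ "k - 1"]) auto
  then show ?thesis using assms that unfolding adjD_def by (metis One_nat_def Suc_eq_plus1 atLeastAtMost_iff)
qed

lemma letter_low:
  assumes "1 \<le> i" "i < n"
  shows "fL t n i x = (if x = Pos i then Some (Pos (Suc i)) else if x = Bar (Suc i) then Some (Bar i) else None)"
    and "phiL t n i x = (if x = Pos i \<or> x = Bar (Suc i) then 1 else 0)"
    and "epsL t n i x = (if x = Pos (Suc i) \<or> x = Bar i then 1 else 0)"
  using assms by (cases x; simp add: phiL_simps epsL_simps)+

lemma letter_topD:
  shows "fL TypeD (Suc (Suc m)) (Suc (Suc m)) x = (if x = Pos (Suc m) then Some (Bar (Suc (Suc m)))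
      else if x = Pos (Suc (Suc m)) then Some (Bar (Suc m)) else None)"
    and "phiL TypeD (Suc (Suc m)) (Suc (Suc m)) x = (if x = Pos (Suc m) \<or> x = Pos (Suc (Suc m)) then 1 else 0)"
    and "epsL TypeD (Suc (Suc m)) (Suc (Suc m)) x = (if x = Bar (Suc m) \<or> x = Bar (Suc (Suc m)) then 1 else 0)"
  by (cases x; simp add: phiL_simps epsL_simps)+

lemma kind_of_eps_phi:
  assumes "i \<in> {1..n}" "j \<in> {1..n}" "adjD n i j"
  shows "kind_phi s (kind_of n i j x) = phiL TypeD n (if s then i else j) x \<and>
    kind_eps s (kind_of n i j x) = epsL TypeD n (if s then i else j) x"
  using assms unfolding kind_of_def
  by (cases rule: adjD_cases; cases s; simp add: letter_low letter_topD)

lemma kind_of_fL: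
  assumes "i \<in> {1..n}" "j \<in> {1..n}" "adjD n i j"
    and "fL TypeD n (if s then i else j) x = Some y"
  shows "kind_of n i j y = kind_f s (kind_of n i j x)"
  using assms unfolding kind_of_def
  by (cases rule: adjD_cases; cases s; auto simp: letter_low letter_topD split: if_split_asm)

lemma fL_orthogonal:
  assumes "2 \<le> n" "i \<in> {1..n}" "j \<in> {1..n}" "i \<noteq> j" "\<not> adjD n i j" "fL TypeD n i x = Some y"
  shows "phiL TypeD n j y = phiL TypeD n j x \<and> epsL TypeD n j y = epsL TypeD n j x"
proof -
  obtain m where n: "n = Suc (Suc m)"
    using assms(1) by (metis add_2_eq_Suc le_Suc_ex)
  have "(i < n \<and> j < n \<and> Suc i \<noteq> j \<and> Suc j \<noteq> i) \<or> (i = n \<and> j < n \<and> j \<noteq> m) \<or> (j = n \<and> i < n \<and> i \<noteq> m)"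
    using assms(2-5) n unfolding adjD_def atLeastAtMost_iff by presburger
  then show ?thesis
    using assms(2-4,6) unfolding n
    by (elim disjE conjE) (auto simp: letter_low letter_topD split: if_split_asm)
qed

lemma fW_orthogonal:
  assumes "\<And>x y. fL t n i x = Some y \<Longrightarrow> phiL t n j y = phiL t n j x \<and> epsL t n j y = epsL t n j x"
  shows "fW t n i w = Some w' \<Longrightarrow> phiW t n j w' = phiW t n j w \<and> epsW t n j w' = epsW t n j w"
proof (induction w arbitrary: w')
  case (Cons x v)
  then show ?case using assms by (auto split: if_splits)
qed simp

text \<open>\<open>P\<close> labels the position of a word in its component for the two operators \<open>i\<close>, \<open>j\<close>,
  up to isomorphism; \<open>S\<close> labels the isomorphism type of the component.\<close>
definition rank2_model ::
    "ctype \<Rightarrow> nat \<Rightarrow> nat \<Rightarrow> nat \<Rightarrow> (letter list \<Rightarrow> 'p) \<Rightarrow> (letter list \<Rightarrow> 's) \<Rightarrow> bool" where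
  "rank2_model t n i j P S \<longleftrightarrow>
     (\<forall>w w'. P w = P w' \<longrightarrow>
        (\<forall>k\<in>{i, j}. epsW t n k w = epsW t n k w' \<and> phiW t n k w = phiW t n k w')) \<and>
     (\<forall>w w' v v'. \<forall>k\<in>{i, j}. P w = P w' \<longrightarrow> fW t n k w = Some v \<longrightarrow> fW t n k w' = Some v' \<longrightarrow> P v = P v') \<and>
     (\<forall>w w' v v'. \<forall>k\<in>{i, j}. P w = P w' \<longrightarrow> eW t n k w = Some v \<longrightarrow> eW t n k w' = Some v' \<longrightarrow> P v = P v') \<and>
     (\<forall>w v. \<forall>k\<in>{i, j}. fW t n k w = Some v \<longrightarrow> S w = S v) \<and>
     (\<forall>w w'. (\<forall>k\<in>{i, j}. epsW t n k w = 0 \<and> epsW t n k w' = 0) \<longrightarrow>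
        S w = S w' \<or> (\<forall>k\<in>{i, j}. phiW t n k w = phiW t n k w') \<longrightarrow> P w = P w')"

lemma rank2_model_adjacent:
  assumes "2 \<le> n" "i \<in> {1..n}" "j \<in> {1..n}" "adjD n i j"
  shows "\<exists>(P :: letter list \<Rightarrow> pattern) (S :: letter list \<Rightarrow> nat \<times> nat). rank2_model TypeD n i j P S"
proof -
  \<comment> \<open>The letters are inserted from right to left, since the tensor rule peels off the
    leftmost letter of a word.\<close>
  define P where "P w = foldr (\<lambda>x. ins (kind_of n i j x)) w (0, 0, 0, 0, 0)" for w
  have P_Nil: "P [] = (0, 0, 0, 0, 0)" and P_Cons: "P (x # v) = ins (kind_of n i j x) (P v)" for x v
    by (simp_all add: P_def)
  note kind = kind_of_eps_phi[OF assms(2-4), THEN conjunct1] kind_of_eps_phi[OF assms(2-4), THEN conjunct2]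
  let ?k = "\<lambda>s. if s then i else j"
  have valid: "pat_valid (P w)" for w
    by (induction w) (auto simp: P_Nil P_Cons pat_valid_ins)
  have ep: "pat_eps s (P w) = epsW TypeD n (?k s) w \<and> pat_phi s (P w) = phiW TypeD n (?k s) w" for w s
    by (induction w)
      (cases s; simp add: P_Nil P_Cons pat_eps_ins pat_phi_ins valid kind del: kind_eps.simps kind_phi.simps)+
  have f: "P w' = pat_f s (P w)" if "fW TypeD n (?k s) w = Some w'" for w w' s
    using that
  proof (induction w arbitrary: w')
    case (Cons x v)
    show ?case
    proof (cases "epsW TypeD n (?k s) v < phiL TypeD n (?k s) x")
      case True
      with Cons.prems obtain y where y: "fL TypeD n (?k s) x = Some y" "w' = y # v" by auto
      show ?thesis
        using True pat_f_ins_left[OF valid, of s v "kind_of n i j x"]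
        by (simp add: y(2) P_Cons kind ep kind_of_fL[OF assms(2-4) y(1)] del: kind_eps.simps kind_phi.simps)
    next
      case False
      with Cons.prems obtain v' where v': "fW TypeD n (?k s) v = Some v'" "w' = x # v'" by auto
      then have "0 < phiW TypeD n (?k s) v" using fW_eq_None_iff[OF assms(1)] by (metis gr0I option.distinct(1))
      then show ?thesis
        using False pat_f_ins_right[OF valid, of s v "kind_of n i j x"] Cons.IH[OF v'(1)]
        by (simp add: v'(2) P_Cons kind ep del: kind_eps.simps kind_phi.simps)
    qed
  qed simp
  have pos: "0 < pat_phi s (P w)" if "fW TypeD n (?k s) w = Some w'" for s w w'
    using that fW_Some_phiW_epsW[OF assms(1) that] by (simp add: ep)
  have e: "P w' = pat_e s (P w)" if "eW TypeD n (?k s) w = Some w'" for w w' s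
    using that f pos pat_e_f[OF valid] by (metis fW_eq_Some_iff[OF assms(1)])
  have S: "pat_shape (P w) = pat_shape (P w')" if "fW TypeD n (?k s) w = Some w'" for w w' s
    using f[OF that] pat_shape_f[OF valid pos[OF that]] by simp
  have top: "P w = P w'"
    if "\<And>s. epsW TypeD n (?k s) w = 0" "\<And>s. epsW TypeD n (?k s) w' = 0"
      "pat_shape (P w) = pat_shape (P w') \<or> (\<forall>s. phiW TypeD n (?k s) w = phiW TypeD n (?k s) w')" for w w'
    using pat_highest[OF valid, of w] pat_highest[OF valid, of w'] that
    by (metis (no_types, lifting) Pair_inject ep)
  have k: "\<exists>s. k = ?k s" if "k \<in> {i, j}" for k
    using that by (metis insertE singletonD)
  have "rank2_model TypeD n i j P (\<lambda>w. pat_shape (P w))"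
    unfolding rank2_model_def
  proof (intro conjI allI ballI impI)
    fix w w' k assume "P w = P w'" "k \<in> {i, j}"
    with k obtain s where "k = ?k s" by blast
    then show "epsW TypeD n k w = epsW TypeD n k w'" "phiW TypeD n k w = phiW TypeD n k w'"
      using ep[of s w] ep[of s w'] \<open>P w = P w'\<close> by simp_all
  next
    fix w w' v v' k assume "k \<in> {i, j}" and *: "P w = P w'" "fW TypeD n k w = Some v" "fW TypeD n k w' = Some v'"
    with k obtain s where "k = ?k s" by blast
    with * f[of s w v] f[of s w' v'] show "P v = P v'" by simp
  next
    fix w w' v v' k assume "k \<in> {i, j}" and *: "P w = P w'" "eW TypeD n k w = Some v" "eW TypeD n k w' = Some v'"
    with k obtain s where "k = ?k s" by blast
    with * e[of s w v] e[of s w' v'] show "P v = P v'" by simp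
  next
    fix w v k assume "k \<in> {i, j}" and *: "fW TypeD n k w = Some v"
    with k obtain s where "k = ?k s" by blast
    with * show "pat_shape (P w) = pat_shape (P v)" by (intro S[of s w v]) simp
  next
    fix w w' assume *: "\<forall>k\<in>{i, j}. epsW TypeD n k w = 0 \<and> epsW TypeD n k w' = 0"
      and **: "pat_shape (P w) = pat_shape (P w') \<or> (\<forall>k\<in>{i, j}. phiW TypeD n k w = phiW TypeD n k w')"
    show "P w = P w'" using * ** by (intro top) auto
  qed
  then show ?thesis by blast
qed

lemma rank2_model_orthogonal:
  assumes "2 \<le> n" "i \<in> {1..n}" "j \<in> {1..n}" "i \<noteq> j" "\<not> adjD n i j"
  shows "\<exists>(P :: letter list \<Rightarrow> pattern) (S :: letter list \<Rightarrow> nat \<times> nat). rank2_model TypeD n i j P S"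
proof -
  let ?e = "epsW TypeD n" and ?p = "phiW TypeD n"
  have ij: "?p j w' = ?p j w \<and> ?e j w' = ?e j w" if "fW TypeD n i w = Some w'" for w w'
    using fW_orthogonal[OF fL_orthogonal[OF assms] that] by simp
  have ji: "?p i w' = ?p i w \<and> ?e i w' = ?e i w" if "fW TypeD n j w = Some w'" for w w'
  proof -
    have "j \<noteq> i" "\<not> adjD n j i" using assms(4,5) by (auto simp: adjD_def)
    then show ?thesis
      using fW_orthogonal[OF fL_orthogonal[OF assms(1) assms(3) assms(2)] that] by simp
  qed
  note inc = fW_Some_phiW_epsW[OF assms(1)] and inv = fW_eq_Some_iff[OF assms(1), symmetric]
  have f_i: "?p j w' = ?p j w \<and> ?e j w' = ?e j w \<and> ?p i w = Suc (?p i w') \<and> ?e i w' = Suc (?e i w)"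
    if "fW TypeD n i w = Some w'" for w w'
    using ij[OF that] inc[OF that] by simp
  have f_j: "?p i w' = ?p i w \<and> ?e i w' = ?e i w \<and> ?p j w = Suc (?p j w') \<and> ?e j w' = Suc (?e j w)"
    if "fW TypeD n j w = Some w'" for w w'
    using ji[OF that] inc[OF that] by simp
  \<comment> \<open>For orthogonal nodes each operator leaves the string of the other untouched, so
    string positions form a complete label and string lengths the isomorphism type. The last entry 0
    is padding, to reuse the type of patterns.\<close>
  have "rank2_model TypeD n i j (\<lambda>w. (?e i w, ?p i w, ?e j w, ?p j w, 0)) (\<lambda>w. (?e i w + ?p i w, ?e j w + ?p j w))"
    unfolding rank2_model_def inv
    by (auto dest!: f_i f_j)
  then show ?thesis by blast
qed

lemma rank2_model_exists:
  assumes "2 \<le> n" "i \<in> {1..n}" "j \<in> {1..n}" "i \<noteq> j"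
  obtains P :: "letter list \<Rightarrow> pattern" and S :: "letter list \<Rightarrow> nat \<times> nat" where "rank2_model TypeD n i j P S"
  using rank2_model_adjacent[OF assms(1-3)] rank2_model_orthogonal[OF assms] by blast


section \<open>Weights and connectedness\<close>

fun wtL :: "letter \<Rightarrow> nat \<Rightarrow> int" where
  "wtL (Pos i) k = (if k = i then 1 else 0)"
| "wtL Zero k = 0"
| "wtL (Bar i) k = (if k = i then - 1 else 0)"

definition wt :: "letter list \<Rightarrow> nat \<Rightarrow> int" where
  "wt w k = (\<Sum>x\<leftarrow>w. wtL x k)"

text \<open>The value of a weight on the i-th simple coroot, in orthogonal coordinates. The factor 2
  in type B comes from the short simple root.\<close>

definition pairing :: "ctype \<Rightarrow> nat \<Rightarrow> nat \<Rightarrow> (nat \<Rightarrow> int) \<Rightarrow> int" where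
  "pairing t n i \<mu> =
     (if i < n then \<mu> i - \<mu> (Suc i) else if t = TypeB then 2 * \<mu> n else \<mu> (n - 1) + \<mu> n)"

definition root :: "ctype \<Rightarrow> nat \<Rightarrow> nat \<Rightarrow> nat \<Rightarrow> int" where
  "root t n i k =
     (if i < n then wtL (Pos i) k - wtL (Pos (Suc i)) k
      else if t = TypeB then wtL (Pos n) k else wtL (Pos (n - 1)) k + wtL (Pos n) k)"

lemma wt_Nil [simp]: "wt [] k = 0" and wt_Cons [simp]: "wt (x # w) k = wtL x k + wt w k"
  and wt_append [simp]: "wt (u @ v) k = wt u k + wt v k"
  by (simp_all add: wt_def)

lemma wtL_inj: "wtL x = wtL y \<Longrightarrow> x = y"
proof -
  assume "wtL x = wtL y"
  then have eq: "wtL x k = wtL y k" for k by simp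
  \<comment> \<open>Evaluating at the index of either letter suffices. For \<open>Zero\<close> the
    index is unspecified, which is harmless because its weight vanishes everywhere and the index of
    the other letter decides.\<close>
  show "x = y"
    using eq[of "case x of Pos i \<Rightarrow> i | Bar i \<Rightarrow> i"] eq[of "case y of Pos i \<Rightarrow> i | Bar i \<Rightarrow> i"]
    by (cases x; cases y) (auto split: if_split_asm)
qed

lemma wtL_fL:
  assumes "2 \<le> n" "i \<in> {1..n}" "fL t n i x = Some y"
  shows "wtL y k = wtL x k - root t n i k"
proof -
  obtain m where n: "n = Suc (Suc m)"
    using assms(1) by (metis add_2_eq_Suc le_Suc_ex)
  consider "i < n" | "i = n" "t = TypeD" | "i = n" "t = TypeB"
    using assms(2) by (cases t) force+
  then show ?thesis
  proof cases
    case 1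
    then show ?thesis using assms(2,3) by (auto simp: letter_low root_def split: if_split_asm)
  next
    case 2
    then show ?thesis using assms(3) unfolding n
      by (auto simp: letter_topD root_def split: if_split_asm)
  next
    case 3
    then show ?thesis using assms(3) by (cases x) (auto simp: root_def split: if_split_asm)
  qed
qed

lemma wt_fW:
  assumes "2 \<le> n" "i \<in> {1..n}"
  shows "fW t n i w = Some w' \<Longrightarrow> wt w' k = wt w k - root t n i k"
  by (induction w arbitrary: w') (auto simp: wtL_fL[OF assms] split: if_split_asm)

lemma pairing_wtL:
  assumes "2 \<le> n" "i \<in> {1..n}"
  shows "int (phiL t n i x) - int (epsL t n i x) = pairing t n i (wtL x)"
proof (cases "i < n")
  case True
  with assms show ?thesis by (cases x) (simp_all add: letter_low pairing_def)
next
  case False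
  with assms have "i = n" by simp
  moreover obtain m where n: "n = Suc (Suc m)"
    using assms(1) by (metis add_2_eq_Suc le_Suc_ex)
  ultimately show ?thesis
    by (cases t; cases x) (simp_all add: letter_topD phiL_simps epsL_simps pairing_def)
qed

text \<open>Both \<epsilon> and \<phi> of a product contain truncated differences, but these
  corrections combine to an integer difference, so \<phi> - \<epsilon> is additive.\<close>

lemma pairing_wt:
  assumes "2 \<le> n" "i \<in> {1..n}"
  shows "int (phiW t n i w) - int (epsW t n i w) = pairing t n i (wt w)"
proof (induction w)
  case (Cons x w)
  have "int (phiW t n i (x # w)) - int (epsW t n i (x # w)) =
    (int (phiL t n i x) - int (epsL t n i x)) + (int (phiW t n i w) - int (epsW t n i w))"
    by simp
  also have "\<dots> = pairing t n i (wtL x) + pairing t n i (wt w)"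
    by (simp only: Cons pairing_wtL[OF assms])
  also have "\<dots> = pairing t n i (wt (x # w))"
    by (simp add: pairing_def)
  finally show ?case .
qed (simp add: pairing_def)

lemma pairing_lin:
  "pairing t n i (\<lambda>k. \<mu> k + a * \<alpha> k + b * \<beta> k) =
     pairing t n i \<mu> + a * pairing t n i \<alpha> + b * pairing t n i \<beta>"
  by (simp add: pairing_def algebra_simps)

lemma pairing_root_self: "2 \<le> n \<Longrightarrow> i \<in> {1..n} \<Longrightarrow> pairing t n i (root t n i) = 2"
  by (auto simp: pairing_def root_def)

lemma pairing_root_D:
  "2 \<le> n \<Longrightarrow> i \<in> {1..n} \<Longrightarrow> j \<in> {1..n} \<Longrightarrow> i \<noteq> j \<Longrightarrow> pairing TypeD n i (root TypeD n j) \<in> {- 1, 0}"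
  by (auto simp: pairing_def root_def)

text \<open>A measure that increases along every arrow in both types, used for all inductions along
  raising paths. The factor 2 leaves room for \<open>Zero\<close> between \<open>Pos n\<close> and
  \<open>Bar n\<close>.\<close>

fun heightL :: "nat \<Rightarrow> letter \<Rightarrow> nat" where
  "heightL n (Pos i) = 2 * i"
| "heightL n Zero = 2 * n + 1"
| "heightL n (Bar i) = 4 * n + 2 - 2 * i"

definition height :: "nat \<Rightarrow> letter list \<Rightarrow> nat" where
  "height n w = (\<Sum>x\<leftarrow>w. heightL n x)"

lemma heightL_fL:
  assumes "2 \<le> n" "i \<in> {1..n}" "fL t n i x = Some y"
  shows "heightL n x < heightL n y"
proof -
  obtain m where n: "n = Suc (Suc m)"
    using assms(1) by (metis add_2_eq_Suc le_Suc_ex)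
  consider "i < n" | "i = n" "t = TypeD" | "i = n" "t = TypeB"
    using assms(2) by (cases t) force+
  then show ?thesis
  proof cases
    case 1
    then show ?thesis using assms(2,3) by (auto simp: letter_low split: if_split_asm)
  next
    case 2
    then show ?thesis using assms(3) unfolding n
      by (auto simp: letter_topD split: if_split_asm)
  next
    case 3
    then show ?thesis using assms(3) by (cases x) (auto split: if_split_asm)
  qed
qed

lemma height_fW:
  assumes "2 \<le> n" "i \<in> {1..n}"
  shows "fW t n i w = Some w' \<Longrightarrow> height n w < height n w'"
  by (induction w arbitrary: w')
    (auto simp: height_def dest: heightL_fL[OF assms] split: if_split_asm)

section \<open>Walks restricted to a set of nodes, and highest words\<close>

definition conn :: "ctype \<Rightarrow> nat \<Rightarrow> nat set \<Rightarrow> (letter list \<times> letter list) set" where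
  "conn t n J = ({(a, b). \<exists>i\<in>J. fW t n i a = Some b} \<union> {(a, b). \<exists>i\<in>J. fW t n i a = Some b}\<inverse>)\<^sup>*"

lemma comp_conn: "comp t n w = {w'. (w, w') \<in> conn t n {1..n}}"
  by (simp add: comp_def conn_def edges_def)

lemma conn_refl [simp]: "(w, w) \<in> conn t n J"
  by (simp add: conn_def)

lemma conn_trans: "(u, v) \<in> conn t n J \<Longrightarrow> (v, w) \<in> conn t n J \<Longrightarrow> (u, w) \<in> conn t n J"
  unfolding conn_def by (rule rtrancl_trans)

lemma conn_sym: "(u, v) \<in> conn t n J \<Longrightarrow> (v, u) \<in> conn t n J"
  unfolding conn_def by (rule symD[OF sym_rtrancl]) (auto simp: sym_def)

lemma conn_fW: "i \<in> J \<Longrightarrow> fW t n i a = Some b \<Longrightarrow> (a, b) \<in> conn t n J"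
  unfolding conn_def by (rule r_into_rtrancl) auto

lemma conn_eW: "2 \<le> n \<Longrightarrow> i \<in> J \<Longrightarrow> eW t n i a = Some b \<Longrightarrow> (a, b) \<in> conn t n J"
  by (metis conn_sym conn_fW fW_eq_Some_iff)

lemma conn_induct [consumes 2, case_names base f e]:
  assumes "(a, b) \<in> conn t n J" "2 \<le> n" "Q a"
    and "\<And>i x y. (a, x) \<in> conn t n J \<Longrightarrow> Q x \<Longrightarrow> i \<in> J \<Longrightarrow> fW t n i x = Some y \<Longrightarrow> Q y"
    and "\<And>i x y. (a, x) \<in> conn t n J \<Longrightarrow> Q x \<Longrightarrow> i \<in> J \<Longrightarrow> eW t n i x = Some y \<Longrightarrow> Q y"
  shows "Q b"
  using assms(1) unfolding conn_def
proof (induction rule: rtrancl_induct)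
  case (step x y)
  then consider i where "i \<in> J" "fW t n i x = Some y" | i where "i \<in> J" "fW t n i y = Some x" by auto
  then show ?case
    using assms(4,5)[of x _ y] step(1,3) fW_eq_Some_iff[OF assms(2)] unfolding conn_def
    by cases metis+
qed (rule assms(3))

text \<open>The operator acts either on the prefix, by the same arrow, or behind it; so every walk
  between words induces a walk between their prefixes.\<close>

lemma fW_take:
  assumes "fW t n i x = Some y"
  shows "take m y = take m x \<or> fW t n i (take m x) = Some (take m y)"
proof (cases "m \<le> length x")
  case True
  then have len: "length (take m x) = m" by simp
  have "fW t n i (take m x @ drop m x) = Some y" using assms by simp
  then consider u' where "fW t n i (take m x) = Some u'" "y = u' @ drop m x"
    | v' where "y = take m x @ v'"
    unfolding fW_append by (auto split: if_split_asm)
  then show ?thesis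
  proof cases
    case 1
    with fW_length[OF 1(1)] len show ?thesis by simp
  next
    case 2
    with len show ?thesis by simp
  qed
next
  case False
  with assms fW_length[OF assms] show ?thesis by simp
qed

lemma conn_prefix:
  assumes "2 \<le> n" "(a, b) \<in> conn t n J"
  shows "length b = length a \<and> (take m a, take m b) \<in> conn t n J"
  using assms(2,1)
proof (induction rule: conn_induct)
  case (f i x y)
  have "(take m x, take m y) \<in> conn t n J"
    using fW_take[OF f.hyps(3), of m] conn_fW[OF f.hyps(2)] by auto
  with f.IH fW_length[OF f.hyps(3)] show ?case using conn_trans by metis
next
  case (e i x y)
  then have fy: "fW t n i y = Some x" by (simp add: fW_eq_Some_iff[OF assms(1)])
  have "(take m y, take m x) \<in> conn t n J"
    using fW_take[OF fy, of m] conn_fW[OF e.hyps(2)] by auto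
  with e.IH fW_length[OF fy] show ?case using conn_trans conn_sym by metis
qed simp

definition highestJ :: "ctype \<Rightarrow> nat \<Rightarrow> nat set \<Rightarrow> letter list \<Rightarrow> bool" where
  "highestJ t n J w \<longleftrightarrow> (\<forall>i\<in>J. epsW t n i w = 0)"

lemma highest_iff: "2 \<le> n \<Longrightarrow> highest t n w \<longleftrightarrow> highestJ t n {1..n} w"
  by (simp add: highest_def highestJ_def eW_eq_None_iff)

lemma highest_prefix: "highestJ t n J (u @ v) \<Longrightarrow> highestJ t n J u"
  by (simp add: highestJ_def epsW_append)

lemma not_highestE:
  assumes "\<not> highestJ t n J w" "2 \<le> n" "J \<subseteq> {1..n}"
  obtains i v where "i \<in> J" "eW t n i w = Some v" "fW t n i v = Some w" "height n v < height n w"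
proof -
  obtain i where i: "i \<in> J" "epsW t n i w \<noteq> 0" using assms(1) by (auto simp: highestJ_def)
  then obtain v where v: "eW t n i w = Some v" using eW_eq_None_iff[OF assms(2), of t i w] by auto
  then have "fW t n i v = Some w" by (simp add: fW_eq_Some_iff[OF assms(2)])
  with i v that height_fW[OF assms(2)] assms(3) show ?thesis by blast
qed

lemma rank2_conn_wt:
  assumes "2 \<le> n" "i \<in> {1..n}" "j \<in> {1..n}" "(a, b) \<in> conn t n {i, j}"
  shows "\<exists>m l. \<forall>k. wt b k = wt a k + m * root t n i k + l * root t n j k"
  using assms(4,1)
proof (induction rule: conn_induct)
  case base
  show ?case by (intro exI[of _ 0]) simp
next
  case (f k x y)
  then obtain m l where ml: "\<And>k. wt x k = wt a k + m * root t n i k + l * root t n j k" by blast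
  have "k \<in> {1..n}" using f.hyps(2) assms(2,3) by auto
  note wt_y = wt_fW[OF assms(1) this f.hyps(3)]
  from f.hyps(2) consider "k = i" | "k = j" by blast
  then show ?case
  proof cases
    case 1
    then show ?thesis using ml wt_y by (intro exI[of _ "m - 1"] exI[of _ l]) (simp add: algebra_simps)
  next
    case 2
    then show ?thesis using ml wt_y by (intro exI[of _ m] exI[of _ "l - 1"]) (simp add: algebra_simps)
  qed
next
  case (e k x y)
  then obtain m l where ml: "\<And>k. wt x k = wt a k + m * root t n i k + l * root t n j k" by blast
  have "k \<in> {1..n}" using e.hyps(2) assms(2,3) by auto
  note wt_x = wt_fW[OF assms(1) this e.hyps(3)[folded fW_eq_Some_iff[OF assms(1)]]]
  have wt_y: "wt y k' = wt x k' + root t n k k'" for k' using wt_x[of k'] by simp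
  from e.hyps(2) consider "k = i" | "k = j" by blast
  then show ?case
  proof cases
    case 1
    then show ?thesis using ml wt_y by (intro exI[of _ "m + 1"] exI[of _ l]) (simp add: algebra_simps)
  next
    case 2
    then show ?thesis using ml wt_y by (intro exI[of _ m] exI[of _ "l + 1"]) (simp add: algebra_simps)
  qed
qed

lemma rank2_model_eps_phi:
  "rank2_model t n i j P S \<Longrightarrow> P w = P w' \<Longrightarrow> k \<in> {i, j} \<Longrightarrow>
    epsW t n k w = epsW t n k w' \<and> phiW t n k w = phiW t n k w'"
  unfolding rank2_model_def by blast

lemma rank2_model_fW:
  "rank2_model t n i j P S \<Longrightarrow> P w = P w' \<Longrightarrow> k \<in> {i, j} \<Longrightarrow>
    fW t n k w = Some v \<Longrightarrow> fW t n k w' = Some v' \<Longrightarrow> P v = P v'"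
  unfolding rank2_model_def by meson

lemma rank2_model_eW:
  "rank2_model t n i j P S \<Longrightarrow> P w = P w' \<Longrightarrow> k \<in> {i, j} \<Longrightarrow>
    eW t n k w = Some v \<Longrightarrow> eW t n k w' = Some v' \<Longrightarrow> P v = P v'"
  unfolding rank2_model_def by meson

lemma rank2_model_S:
  "rank2_model t n i j P S \<Longrightarrow> k \<in> {i, j} \<Longrightarrow> fW t n k w = Some v \<Longrightarrow> S w = S v"
  unfolding rank2_model_def by meson

text \<open>The disjunction serves two purposes: equality of \<open>S\<close> compares highest words
  of one component, equality of \<phi> compares highest words of different components.\<close>

lemma rank2_model_top:
  "rank2_model t n i j P S \<Longrightarrow> \<forall>k\<in>{i, j}. epsW t n k w = 0 \<Longrightarrow> \<forall>k\<in>{i, j}. epsW t n k w' = 0 \<Longrightarrow>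
    S w = S w' \<or> (\<forall>k\<in>{i, j}. phiW t n k w = phiW t n k w') \<Longrightarrow> P w = P w'"
  unfolding rank2_model_def by meson

lemma rank2_model_conn:
  assumes "2 \<le> n" "rank2_model t n i j P S" "(a, b) \<in> conn t n {i, j}"
  shows "S a = S b"
  using assms(3,1)
proof (induction rule: conn_induct)
  case (f k x y)
  then show ?case using rank2_model_S[OF assms(2)] by metis
next
  case (e k x y)
  then show ?case using rank2_model_S[OF assms(2)] fW_eq_Some_iff[OF assms(1)] by metis
qed simp

text \<open>Prefixes of highest words are highest and prefixes of connected words connected, so only
  the last letters can differ. The model forces equal \<phi>, hence equal weights, and the weight
  determines a letter.\<close>

lemma rank2_highest_unique:
  assumes n: "2 \<le> n" and ij: "i \<in> {1..n}" "j \<in> {1..n}" "i \<noteq> j" and P: "rank2_model TypeD n i j P S"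
  shows "(a, b) \<in> conn TypeD n {i, j} \<Longrightarrow> highestJ TypeD n {i, j} a \<Longrightarrow> highestJ TypeD n {i, j} b \<Longrightarrow> a = b"
proof (induction a arbitrary: b rule: rev_induct)
  case Nil
  then show ?case using conn_prefix[OF n] by force
next
  case (snoc x u)
  have len: "length b = Suc (length u)" using conn_prefix[OF n snoc(2)] by simp
  then obtain v y where b: "b = v @ [y]" "length v = length u" by (metis length_append_singleton length_Suc_conv_rev nat.inject)
  have "(u, v) \<in> conn TypeD n {i, j}" using conn_prefix[OF n snoc(2), of "length u"] b by simp
  then have uv: "u = v" using snoc highest_prefix b by blast
  have "S (u @ [x]) = S b" by (rule rank2_model_conn[OF n P snoc(2)])
  then have "P (u @ [x]) = P b"
    using rank2_model_top[OF P] snoc(3,4) unfolding highestJ_def by blast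
  then have eq: "epsW TypeD n k (u @ [x]) = epsW TypeD n k b \<and> phiW TypeD n k (u @ [x]) = phiW TypeD n k b"
    if "k \<in> {i, j}" for k
    using rank2_model_eps_phi[OF P] that by blast
  obtain m l where ml: "\<And>k. wt b k = wt (u @ [x]) k + m * root TypeD n i k + l * root TypeD n j k"
    using rank2_conn_wt[OF n ij(1,2) snoc(2)] by blast
  then have wtb: "wt b = (\<lambda>k. wt (u @ [x]) k + m * root TypeD n i k + l * root TypeD n j k)" by blast
  have "pairing TypeD n k (wt b) = pairing TypeD n k (wt (u @ [x]))" if "k \<in> {i, j}" for k
    using eq[OF that] pairing_wt[OF n, of k] that ij by (metis insertE singletonD)
  then have "m * pairing TypeD n k (root TypeD n i) + l * pairing TypeD n k (root TypeD n j) = 0" if "k \<in> {i, j}" for k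
    using that unfolding wtb pairing_lin by fastforce
  \<comment> \<open>The coefficients solve a homogeneous system whose matrix has diagonal 2 and
    off-diagonal entries 0 or -1, hence determinant at least 3.\<close>
  from this[of i] this[of j]
  have "m = 0 \<and> l = 0"
    using pairing_root_D[OF n ij] pairing_root_D[OF n ij(2,1)] ij(3)
      pairing_root_self[OF n ij(1)] pairing_root_self[OF n ij(2)] by auto
  then have "wtL y k = wtL x k" for k using ml[of k] b uv by simp
  then have "wtL y = wtL x" by blast
  then show ?case using wtL_inj b uv by blast
qed


section \<open>Isomorphisms of components\<close>

text \<open>A relation rather than a function: that different paths to the same vertex yield the
  same partner is what has to be proved.\<close>

inductive_set rel :: "ctype \<Rightarrow> nat \<Rightarrow> letter list \<Rightarrow> letter list \<Rightarrow> (letter list \<times> letter list) set"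
  for t n h h' where
  base: "(h, h') \<in> rel t n h h'"
| step: "(x, x') \<in> rel t n h h' \<Longrightarrow> i \<in> {1..n} \<Longrightarrow> fW t n i x = Some y \<Longrightarrow> fW t n i x' = Some y' \<Longrightarrow>
    (y, y') \<in> rel t n h h'"

text \<open>Stability under lowering is built into \<open>rel\<close>; this is the missing stability
  under raising, together with the equality of string data that lets both words move
  simultaneously.\<close>

definition ok_pair :: "ctype \<Rightarrow> nat \<Rightarrow> (letter list \<times> letter list) set \<Rightarrow> letter list \<Rightarrow> letter list \<Rightarrow> bool" where
  "ok_pair t n R x x' \<longleftrightarrow> (\<forall>i\<in>{1..n}. epsW t n i x = epsW t n i x' \<and> phiW t n i x = phiW t n i x' \<and>
     (\<forall>y y'. eW t n i x = Some y \<longrightarrow> eW t n i x' = Some y' \<longrightarrow> (y, y') \<in> R))"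

definition matched :: "ctype \<Rightarrow> nat \<Rightarrow> letter list \<Rightarrow> letter list \<Rightarrow> bool" where
  "matched t n h h' \<longleftrightarrow> highestJ t n {1..n} h \<and> highestJ t n {1..n} h' \<and>
     (\<forall>(x, x')\<in>rel t n h h'. ok_pair t n (rel t n h h') x x')"

text \<open>A related pair is raised through the nodes i, j to a pair that is highest for both; it
  stays related since \<open>ok_pair\<close> is known below height \<open>m\<close>. At the top
  equal \<phi> gives equal labels, which are then carried back down.\<close>

lemma rank2_raise:
  assumes n: "2 \<le> n" and ij: "i \<in> {1..n}" "j \<in> {1..n}" and P: "rank2_model t n i j P S"
    and ok: "\<And>y y'. (y, y') \<in> rel t n h h' \<Longrightarrow> height n y < m \<Longrightarrow> ok_pair t n (rel t n h h') y y'"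
  shows "(z, z') \<in> rel t n h h' \<Longrightarrow> height n z < m \<Longrightarrow> P z = P z' \<and>
    (\<exists>b b'. (b, b') \<in> rel t n h h' \<and> highestJ t n {i, j} b \<and> highestJ t n {i, j} b' \<and>
      (b, z) \<in> conn t n {i, j} \<and> (b', z') \<in> conn t n {i, j})"
proof (induction "height n z" arbitrary: z z' rule: less_induct)
  case less
  note okz = ok[OF less(2,3), unfolded ok_pair_def]
  have sub: "{i, j} \<subseteq> {1..n}" using ij by auto
  show ?case
  proof (cases "highestJ t n {i, j} z")
    case True
    then have hi: "highestJ t n {i, j} z'" using okz sub by (auto simp: highestJ_def)
    moreover have "P z = P z'"
      using True hi okz sub by (intro rank2_model_top[OF P]) (auto simp: highestJ_def)
    ultimately show ?thesis using True less(2) conn_refl by blast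
  next
    case False
    then obtain k r where r: "k \<in> {i, j}" "eW t n k z = Some r" "fW t n k r = Some z" "height n r < height n z"
      using not_highestE[OF _ n sub] by metis
    then have k: "k \<in> {1..n}" using sub by blast
    have "epsW t n k z' \<noteq> 0" using okz k r(2) eW_eq_None_iff[OF n, of t k z] by auto
    then obtain r' where r': "eW t n k z' = Some r'" using eW_eq_None_iff[OF n, of t k z'] by auto
    then have fr': "fW t n k r' = Some z'" by (simp add: fW_eq_Some_iff[OF n])
    have "(r, r') \<in> rel t n h h'" using okz k r(2) r' by blast
    from less(1)[OF r(4) this] r(4) less(3) obtain b b' where b: "P r = P r'" "(b, b') \<in> rel t n h h'"
      "highestJ t n {i, j} b" "highestJ t n {i, j} b'" "(b, r) \<in> conn t n {i, j}" "(b', r') \<in> conn t n {i, j}"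
      by auto
    have "P z = P z'" by (rule rank2_model_fW[OF P b(1) r(1,3) fr'])
    moreover have "(b, z) \<in> conn t n {i, j}" "(b', z') \<in> conn t n {i, j}"
      using b(5,6) conn_fW[OF r(1)] r(3) fr' conn_trans by metis+
    ultimately show ?thesis using b(2-4) by blast
  qed
qed

text \<open>Conversely, two words with equal labels below \<open>b\<close> and \<open>b'\<close> can
  be raised in parallel. They reach \<open>b\<close> and \<open>b'\<close> because highest words of
  rank-two components are unique, and reversing the path puts the words into
  \<open>rel\<close>.\<close>

lemma rank2_lower:
  assumes n: "2 \<le> n" and ij: "i \<in> {1..n}" "j \<in> {1..n}" "i \<noteq> j" and P: "rank2_model TypeD n i j P S"
    and b: "(b, b') \<in> rel TypeD n h h'" "highestJ TypeD n {i, j} b" "highestJ TypeD n {i, j} b'"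
  shows "P z = P z' \<Longrightarrow> (b, z) \<in> conn TypeD n {i, j} \<Longrightarrow> (b', z') \<in> conn TypeD n {i, j} \<Longrightarrow>
    (z, z') \<in> rel TypeD n h h'"
proof (induction "height n z" arbitrary: z z' rule: less_induct)
  case less
  have sub: "{i, j} \<subseteq> {1..n}" using ij by auto
  show ?case
  proof (cases "highestJ TypeD n {i, j} z")
    case True
    then have "highestJ TypeD n {i, j} z'"
      using rank2_model_eps_phi[OF P less(2)] unfolding highestJ_def by metis
    then have "b = z" "b' = z'"
      using True rank2_highest_unique[OF n ij P] b less(3,4) by blast+
    then show ?thesis using b(1) by simp
  next
    case False
    then obtain k r where r: "k \<in> {i, j}" "eW TypeD n k z = Some r" "fW TypeD n k r = Some z" "height n r < height n z"
      using not_highestE[OF _ n sub] by metis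
    then have k: "k \<in> {1..n}" using sub by blast
    have "epsW TypeD n k z' \<noteq> 0"
      using rank2_model_eps_phi[OF P less(2) r(1)] r(2) eW_eq_None_iff[OF n, of TypeD k z] by auto
    then obtain r' where r': "eW TypeD n k z' = Some r'" using eW_eq_None_iff[OF n, of TypeD k z'] by auto
    then have fr': "fW TypeD n k r' = Some z'" by (simp add: fW_eq_Some_iff[OF n])
    have "P r = P r'" by (rule rank2_model_eW[OF P less(2) r(1,2) r'])
    moreover have "(b, r) \<in> conn TypeD n {i, j}" "(b', r') \<in> conn TypeD n {i, j}"
      using less(3,4) conn_eW[OF n r(1)] r(2) r' conn_trans by metis+
    ultimately have "(r, r') \<in> rel TypeD n h h'" using less(1)[OF r(4)] by blast
    then show ?thesis using rel.step[OF _ k r(3) fr'] by blast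
  qed
qed

text \<open>The diamond argument: if x arises from y by node i and is to be raised by node j, climb
  from y to the top of its {i, j}-component and come down to the raised word. All pairs met on the
  climb are strictly higher up than x, so the induction hypothesis applies to them.\<close>

lemma matched_D:
  assumes n: "2 \<le> n" and h: "highestJ TypeD n {1..n} h" "highestJ TypeD n {1..n} h'"
    and phi: "\<And>i. i \<in> {1..n} \<Longrightarrow> phiW TypeD n i h = phiW TypeD n i h'"
  shows "matched TypeD n h h'"
proof -
  let ?R = "rel TypeD n h h'"
  have "ok_pair TypeD n ?R x x'" if "(x, x') \<in> ?R" for x x'
    using that
  proof (induction "height n x" arbitrary: x x' rule: less_induct)
    case less
    from less(2) show ?case
    proof (cases rule: rel.cases)
      case base
      have "eW TypeD n i h = None" if "i \<in> {1..n}" for i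
        using h(1) that eW_eq_None_iff[OF n, of TypeD i h] unfolding highestJ_def by simp
      then show ?thesis using base h phi unfolding ok_pair_def highestJ_def by simp
    next
      case (step y y' i)
      have lt: "height n y < height n x" by (rule height_fW[OF n step(2,3)])
      have ok_j: "epsW TypeD n k x = epsW TypeD n k x' \<and> phiW TypeD n k x = phiW TypeD n k x' \<and>
          (\<forall>z z'. eW TypeD n k x = Some z \<longrightarrow> eW TypeD n k x' = Some z' \<longrightarrow> (z, z') \<in> ?R)"
        if j: "j \<in> {1..n}" "j \<noteq> i" and k: "k \<in> {i, j}" for j k
      proof -
        obtain P :: "letter list \<Rightarrow> pattern" and S :: "letter list \<Rightarrow> nat \<times> nat"
          where P: "rank2_model TypeD n i j P S"
          using rank2_model_exists[OF n step(2) j(1)] j(2) by metis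
        obtain b b' where b: "P y = P y'" "(b, b') \<in> ?R"
          "highestJ TypeD n {i, j} b" "highestJ TypeD n {i, j} b'"
          "(b, y) \<in> conn TypeD n {i, j}" "(b', y') \<in> conn TypeD n {i, j}"
          using rank2_raise[OF n step(2) j(1) P less(1) step(1) lt] by blast
        have Px: "P x = P x'" using rank2_model_fW[OF P b(1) _ step(3,4)] by simp
        have cx: "(b, x) \<in> conn TypeD n {i, j}" "(b', x') \<in> conn TypeD n {i, j}"
          using b(5,6) conn_fW[of i "{i, j}"] step(3,4) conn_trans by (metis insertI1)+
        have "(z, z') \<in> ?R" if z: "eW TypeD n k x = Some z" "eW TypeD n k x' = Some z'" for z z'
        proof (rule rank2_lower[OF n step(2) j(1) j(2)[symmetric] P b(2-4)])
          show "P z = P z'" by (rule rank2_model_eW[OF P Px k z])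
          show "(b, z) \<in> conn TypeD n {i, j}" "(b', z') \<in> conn TypeD n {i, j}"
            using cx conn_eW[OF n k] z conn_trans by metis+
        qed
        then show ?thesis using rank2_model_eps_phi[OF P Px k] by blast
      qed
      \<comment> \<open>The node i itself is treated inside a pair with any other node, which exists
        as there are at least two nodes.\<close>
      have "\<exists>j. j \<in> {1..n} \<and> j \<noteq> i"
        using n by (intro exI[of _ "if i = 1 then 2 else 1"]) auto
      then show ?thesis
        unfolding ok_pair_def using ok_j by (metis insertCI)
    qed
  qed
  then show ?thesis using h by (auto simp: matched_def)
qed

lemma rel_swap: "(x, x') \<in> rel t n h h' \<Longrightarrow> (x', x) \<in> rel t n h' h"
  by (induction rule: rel.induct) (auto intro: rel.intros)

lemma rel_conn: "(x, x') \<in> rel t n h h' \<Longrightarrow> (h, x) \<in> conn t n {1..n} \<and> (h', x') \<in> conn t n {1..n}"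
proof (induction rule: rel.induct)
  case (step x x' i y y')
  then show ?case using conn_fW conn_trans by metis
qed simp

lemma rel_fseq:
  "(x, x') \<in> rel t n h h' \<Longrightarrow> \<exists>is. set is \<subseteq> {1..n} \<and> fseq t n is h = Some x \<and> fseq t n is h' = Some x'"
proof (induction rule: rel.induct)
  case base
  show ?case by (intro exI[of _ "[]"]) simp
next
  case (step x x' i y y')
  then obtain s where "set s \<subseteq> {1..n}" "fseq t n s h = Some x" "fseq t n s h' = Some x'" by blast
  with step show ?case by (intro exI[of _ "i # s"]) auto
qed

lemma matchedD:
  assumes "matched t n h h'"
  shows "highestJ t n {1..n} h" "highestJ t n {1..n} h'"
    and "(x, x') \<in> rel t n h h' \<Longrightarrow> i \<in> {1..n} \<Longrightarrow> epsW t n i x = epsW t n i x' \<and> phiW t n i x = phiW t n i x'"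
    and "(x, x') \<in> rel t n h h' \<Longrightarrow> i \<in> {1..n} \<Longrightarrow> eW t n i x = Some y \<Longrightarrow> eW t n i x' = Some y' \<Longrightarrow>
      (y, y') \<in> rel t n h h'"
  using assms unfolding matched_def ok_pair_def by blast+

lemma matched_swap:
  assumes "matched t n h h'"
  shows "matched t n h' h"
proof -
  have "ok_pair t n (rel t n h' h) x x'" if "(x, x') \<in> rel t n h' h" for x x'
    unfolding ok_pair_def
  proof (intro ballI conjI allI impI)
    fix i assume i: "i \<in> {1..n}"
    note x = rel_swap[OF that]
    show "epsW t n i x = epsW t n i x'" "phiW t n i x = phiW t n i x'"
      using matchedD(3)[OF assms x i] by simp_all
    fix y y' assume "eW t n i x = Some y" "eW t n i x' = Some y'"
    then show "(y, y') \<in> rel t n h' h" using matchedD(4)[OF assms x i] rel_swap by blast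
  qed
  then show ?thesis using matchedD(1,2)[OF assms] unfolding matched_def by blast
qed

lemma matched_total:
  assumes n: "2 \<le> n" and m: "matched t n h h'" and "(h, x) \<in> conn t n {1..n}"
  shows "\<exists>x'. (x, x') \<in> rel t n h h'"
  using assms(3) n
proof (induction rule: conn_induct)
  case base
  show ?case using rel.base by blast
next
  case (f i x y)
  then obtain x' where x': "(x, x') \<in> rel t n h h'" by blast
  have "phiW t n i x' \<noteq> 0"
    using matchedD(3)[OF m x' f.hyps(2)] f.hyps(3) fW_eq_None_iff[OF n, of t i x] by auto
  then obtain y' where "fW t n i x' = Some y'" using fW_eq_None_iff[OF n, of t i x'] by auto
  then show ?case using rel.step[OF x' f.hyps(2,3)] by blast
next
  case (e i x y)
  then obtain x' where x': "(x, x') \<in> rel t n h h'" by blast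
  have "epsW t n i x' \<noteq> 0"
    using matchedD(3)[OF m x' e.hyps(2)] e.hyps(3) eW_eq_None_iff[OF n, of t i x] by auto
  then obtain y' where "eW t n i x' = Some y'" using eW_eq_None_iff[OF n, of t i x'] by auto
  then show ?case using matchedD(4)[OF m x' e.hyps(2,3)] by blast
qed

text \<open>A pair produced by a lowering step has positive \<epsilon>, so a highest word occurs
  only in the base pair. Applied to a matched component, this yields the uniqueness of its highest
  word.\<close>

lemma rel_highest:
  assumes n: "2 \<le> n" and "(x, x') \<in> rel t n h h'" "highestJ t n {1..n} x"
  shows "x = h \<and> x' = h'"
  using assms(2)
proof (cases rule: rel.cases)
  case (step y y' i)
  then show ?thesis
    using fW_Some_phiW_epsW[OF n step(3)] assms(3) by (auto simp: highestJ_def)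
qed simp

lemma highest_unique:
  assumes "2 \<le> n" "matched t n h h'" "(h, x) \<in> conn t n {1..n}" "highestJ t n {1..n} x"
  shows "x = h"
  using matched_total[OF assms(1-3)] rel_highest[OF assms(1)] assms(4) by blast

lemma rel_functional:
  assumes n: "2 \<le> n" and m: "matched t n h h'"
  shows "(x, x') \<in> rel t n h h' \<Longrightarrow> (x, x'') \<in> rel t n h h' \<Longrightarrow> x' = x''"
proof (induction "height n x" arbitrary: x x' x'' rule: less_induct)
  case less
  show ?case
  proof (cases "highestJ t n {1..n} x")
    case True
    then show ?thesis using rel_highest[OF n] less(2,3) by blast
  next
    case False
    then obtain i r where r: "i \<in> {1..n}" "eW t n i x = Some r" "fW t n i r = Some x" "height n r < height n x"
      using not_highestE[OF _ n] by (metis subset_refl)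
    have "epsW t n i x \<noteq> 0" using r(2) eW_eq_None_iff[OF n, of t i x] by auto
    then have "epsW t n i x' \<noteq> 0" "epsW t n i x'' \<noteq> 0"
      using matchedD(3)[OF m less(2) r(1)] matchedD(3)[OF m less(3) r(1)] by auto
    then obtain r' r'' where r': "eW t n i x' = Some r'" "eW t n i x'' = Some r''"
      using eW_eq_None_iff[OF n, of t i x'] eW_eq_None_iff[OF n, of t i x''] by auto
    then have "r' = r''"
      using less(1)[OF r(4)] matchedD(4)[OF m less(2) r(1,2)] matchedD(4)[OF m less(3) r(1,2)] by blast
    then show ?thesis using r' by (metis fW_eq_Some_iff[OF n] option.inject)
  qed
qed

lemma matched_comp_iso:
  assumes n: "2 \<le> n" and m: "matched t n h h'"
  obtains g where "comp_iso t n g h h'" "g h = h'" "\<And>x. x \<in> comp t n h \<Longrightarrow> (x, g x) \<in> rel t n h h'"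
proof -
  define g where "g x = (SOME x'. (x, x') \<in> rel t n h h')" for x
  have g: "(x, g x) \<in> rel t n h h'" if "x \<in> comp t n h" for x
    using matched_total[OF n m] that unfolding g_def comp_conn by (auto intro: someI_ex)
  have g_eq: "g x = x'" if "(x, x') \<in> rel t n h h'" for x x'
    using that rel_functional[OF n m] unfolding g_def by (metis someI)
  have "g h = h'" using g_eq rel.base by blast
  moreover have "comp_iso t n g h h'"
    unfolding comp_iso_def
  proof
    show "bij_betw g (comp t n h) (comp t n h')"
      unfolding bij_betw_def
    proof
      show "inj_on g (comp t n h)"
        using g rel_swap rel_functional[OF n matched_swap[OF m]] by (metis inj_onI)
      show "g ` comp t n h = comp t n h'"
      proof (intro equalityI subsetI)
        fix y assume "y \<in> g ` comp t n h"
        then show "y \<in> comp t n h'" using g rel_conn unfolding comp_conn by blast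
      next
        fix y assume "y \<in> comp t n h'"
        then obtain x where "(y, x) \<in> rel t n h' h"
          using matched_total[OF n matched_swap[OF m]] unfolding comp_conn by blast
        then have "(x, y) \<in> rel t n h h'" by (rule rel_swap)
        then show "y \<in> g ` comp t n h" using g_eq rel_conn unfolding comp_conn by blast
      qed
    qed
    show "\<forall>x\<in>comp t n h. \<forall>i\<in>{1..n}. map_option g (fW t n i x) = fW t n i (g x)"
    proof (intro ballI)
      fix x i assume x: "x \<in> comp t n h" and i: "i \<in> {1..n}"
      note eq = matchedD(3)[OF m g[OF x] i]
      show "map_option g (fW t n i x) = fW t n i (g x)"
      proof (cases "fW t n i x")
        case None
        then show ?thesis using eq fW_eq_None_iff[OF n, of t i x] fW_eq_None_iff[OF n, of t i "g x"] by auto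
      next
        case (Some y)
        then obtain y' where y': "fW t n i (g x) = Some y'"
          using eq fW_eq_None_iff[OF n, of t i x] fW_eq_None_iff[OF n, of t i "g x"] by auto
        then show ?thesis using Some g_eq[OF rel.step[OF g[OF x] i Some y']] by simp
      qed
    qed
  qed
  ultimately show ?thesis using that g by blast
qed

lemma highest_exists:
  assumes n: "2 \<le> n"
  obtains h where "highestJ t n {1..n} h" "(h, w) \<in> conn t n {1..n}"
proof -
  have "\<exists>h. highestJ t n {1..n} h \<and> (h, w) \<in> conn t n {1..n}"
  proof (induction "height n w" arbitrary: w rule: less_induct)
    case less
    show ?case
    proof (cases "highestJ t n {1..n} w")
      case False
      then obtain i r where r: "i \<in> {1..n}" "fW t n i r = Some w" "height n r < height n w"
        using not_highestE[OF _ n] by (metis subset_refl)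
      with less obtain h where "highestJ t n {1..n} h" "(h, r) \<in> conn t n {1..n}" by blast
      then show ?thesis using r conn_fW conn_trans by metis
    qed (use conn_refl in blast)
  qed
  then show ?thesis using that by blast
qed


section \<open>Type B inside type D\<close>

text \<open>In D_{n+1} a type B operator with i < n becomes \<open>f\<^sub>i\<close> applied twice,
  and the one for n becomes \<open>f\<^sub>n\<close> followed by
  \<open>f\<^sub>n\<^sub>+\<^sub>1\<close>. The image of \<open>Zero\<close> is what the latter
  makes of \<open>[Pos n, Pos n]\<close>.\<close>

fun vir :: "nat \<Rightarrow> letter \<Rightarrow> letter list" where
  "vir n (Pos i) = [Pos i, Pos i]"
| "vir n Zero = [Bar n, Pos n]"
| "vir n (Bar i) = [Bar i, Bar i]"

definition virW :: "nat \<Rightarrow> letter list \<Rightarrow> letter list" where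
  "virW n w = concat (map (vir n) w)"

lemma virW_Nil [simp]: "virW n [] = []" and virW_Cons [simp]: "virW n (x # w) = vir n x @ virW n w"
  by (simp_all add: virW_def)

lemma virW_inj: "virW n w = virW n w' \<Longrightarrow> w = w'"
proof (induction w arbitrary: w')
  case Nil
  then show ?case by (cases w') (auto elim: vir.elims)
next
  case (Cons x w)
  then obtain y u where w': "w' = y # u" by (cases w'; cases x) auto
  with Cons show ?case by (cases x; cases y) auto
qed

lemma fL_alph: "2 \<le> n \<Longrightarrow> i \<in> {1..n} \<Longrightarrow> fL TypeB n i x = Some y \<Longrightarrow> x \<in> alphB n \<longleftrightarrow> y \<in> alphB n"
  by (cases x) (auto simp: alphB_def split: if_split_asm)

lemma fW_alph:
  assumes "2 \<le> n" "i \<in> {1..n}"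
  shows "fW TypeB n i w = Some w' \<Longrightarrow> set w \<subseteq> alphB n \<longleftrightarrow> set w' \<subseteq> alphB n"
  by (induction w arbitrary: w') (auto dest: fL_alph[OF assms] split: if_split_asm)

lemma vir_low:
  assumes "x \<in> alphB n" "1 \<le> i" "i < n"
  shows "epsW TypeD (Suc n) i (vir n x) = 2 * epsL TypeB n i x"
    and "phiW TypeD (Suc n) i (vir n x) = 2 * phiL TypeB n i x"
  using assms by (cases x; auto simp: letter_low)+

lemma vir_top:
  assumes "2 \<le> n" "x \<in> alphB n" "k \<in> {n, Suc n}"
  shows "epsW TypeD (Suc n) k (vir n x) = epsL TypeB n n x \<and>
    phiW TypeD (Suc n) k (vir n x) = phiL TypeB n n x"
proof -
  obtain m where n: "n = Suc m" using assms(1) by (cases n) auto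
  show ?thesis
    using assms unfolding n
    by (cases x) (auto simp: alphB_def letter_low letter_topD phiL_simps epsL_simps)
qed

lemma virW_low:
  assumes "1 \<le> i" "i < n"
  shows "set w \<subseteq> alphB n \<Longrightarrow> epsW TypeD (Suc n) i (virW n w) = 2 * epsW TypeB n i w \<and>
    phiW TypeD (Suc n) i (virW n w) = 2 * phiW TypeB n i w"
  by (induction w) (auto simp: epsW_append phiW_append vir_low[OF _ assms])

lemma virW_top:
  assumes "2 \<le> n" "k \<in> {n, Suc n}"
  shows "set w \<subseteq> alphB n \<Longrightarrow> epsW TypeD (Suc n) k (virW n w) = epsW TypeB n n w \<and>
    phiW TypeD (Suc n) k (virW n w) = phiW TypeB n n w"
  by (induction w) (auto simp: epsW_append phiW_append vir_top[OF assms(1) _ assms(2)])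

lemma vir_f_low:
  assumes "x \<in> alphB n" "1 \<le> i" "i < n" "fL TypeB n i x = Some y"
  shows "\<exists>z. fW TypeD (Suc n) i (vir n x) = Some z \<and> fW TypeD (Suc n) i z = Some (vir n y)"
  using assms by (auto simp: letter_low split: if_split_asm)

lemma vir_f_top:
  assumes "2 \<le> n" "x \<in> alphB n" "fL TypeB n n x = Some y"
  shows "\<exists>z. fW TypeD (Suc n) n (vir n x) = Some z \<and> fW TypeD (Suc n) (Suc n) z = Some (vir n y)"
proof -
  obtain m where n: "n = Suc m" using assms(1) by (cases n) auto
  show ?thesis
    using assms unfolding n
    by (cases x) (auto simp: letter_low letter_topD split: if_split_asm)
qed

text \<open>Both applications act on the same factor because all string lengths are doubled: 2a > 2b
  implies 2a - 1 > 2b, and in the other case the first application only increases \<epsilon> of the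
  right factor.\<close>

lemma virW_f_low:
  assumes i: "1 \<le> i" "i < n"
  shows "set w \<subseteq> alphB n \<Longrightarrow> fW TypeB n i w = Some w' \<Longrightarrow>
    \<exists>z. fW TypeD (Suc n) i (virW n w) = Some z \<and> fW TypeD (Suc n) i z = Some (virW n w')"
proof (induction w arbitrary: w')
  case (Cons x v)
  then have x: "x \<in> alphB n" and v: "set v \<subseteq> alphB n" by auto
  have n: "2 \<le> Suc n" using i by simp
  note e = virW_low[OF i v] and ex = vir_low[OF x i]
  note inc = fW_Some_phiW_epsW[OF n]
  show ?case
  proof (cases "phiL TypeB n i x > epsW TypeB n i v")
    case True
    with Cons.prems obtain y where y: "fL TypeB n i x = Some y" "w' = y # v" by auto
    obtain z where z: "fW TypeD (Suc n) i (vir n x) = Some z" "fW TypeD (Suc n) i z = Some (vir n y)"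
      using vir_f_low[OF x i y(1)] by blast
    show ?thesis
      using True z y(2) e ex inc[OF z(1)] by (auto simp: fW_append)
  next
    case False
    with Cons.prems obtain v' where v': "fW TypeB n i v = Some v'" "w' = x # v'" by auto
    obtain z where z: "fW TypeD (Suc n) i (virW n v) = Some z" "fW TypeD (Suc n) i z = Some (virW n v')"
      using Cons.IH[OF v v'(1)] by blast
    show ?thesis
      using False z v'(2) e ex inc[OF z(1)] by (auto simp: fW_append)
  qed
qed simp

text \<open>The nodes n and n + 1 of D_{n+1} are orthogonal and have equal string data on images, so
  applying the first does not change the factor on which the second acts.\<close>

lemma virW_f_top:
  assumes n: "2 \<le> n"
  shows "set w \<subseteq> alphB n \<Longrightarrow> fW TypeB n n w = Some w' \<Longrightarrow>
    \<exists>z. fW TypeD (Suc n) n (virW n w) = Some z \<and> fW TypeD (Suc n) (Suc n) z = Some (virW n w')"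
proof (induction w arbitrary: w')
  case (Cons x v)
  then have x: "x \<in> alphB n" and v: "set v \<subseteq> alphB n" by auto
  note e = virW_top[OF n _ v] and ex = vir_top[OF n x]
  have orth: "phiL TypeD (Suc n) (Suc n) y = phiL TypeD (Suc n) (Suc n) x \<and> epsL TypeD (Suc n) (Suc n) y = epsL TypeD (Suc n) (Suc n) x"
    if "fL TypeD (Suc n) n x = Some y" for x y
    using n that by (intro fL_orthogonal[of "Suc n" n "Suc n"]) (auto simp: adjD_def)
  have inc: "phiW TypeD (Suc n) (Suc n) u' = phiW TypeD (Suc n) (Suc n) u \<and>
      epsW TypeD (Suc n) (Suc n) u' = epsW TypeD (Suc n) (Suc n) u"
    if "fW TypeD (Suc n) n u = Some u'" for u u'
    by (rule fW_orthogonal[OF _ that]) (rule orth)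
  show ?case
  proof (cases "phiL TypeB n n x > epsW TypeB n n v")
    case True
    with Cons.prems obtain y where y: "fL TypeB n n x = Some y" "w' = y # v" by auto
    obtain z where z: "fW TypeD (Suc n) n (vir n x) = Some z" "fW TypeD (Suc n) (Suc n) z = Some (vir n y)"
      using vir_f_top[OF n x y(1)] by blast
    show ?thesis
      using True z y(2) e ex inc[OF z(1)] by (auto simp: fW_append)
  next
    case False
    with Cons.prems obtain v' where v': "fW TypeB n n v = Some v'" "w' = x # v'" by auto
    obtain z where z: "fW TypeD (Suc n) n (virW n v) = Some z" "fW TypeD (Suc n) (Suc n) z = Some (virW n v')"
      using Cons.IH[OF v v'(1)] by blast
    show ?thesis
      using False z v'(2) e ex inc[OF z(1)] by (auto simp: fW_append)
  qed
qed simp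

lemma rel_virW:
  assumes n: "2 \<le> n" and h: "set h \<subseteq> alphB n" "set h' \<subseteq> alphB n"
  shows "(x, x') \<in> rel TypeB n h h' \<Longrightarrow> set x \<subseteq> alphB n \<and> set x' \<subseteq> alphB n \<and>
    (virW n x, virW n x') \<in> rel TypeD (Suc n) (virW n h) (virW n h')"
proof (induction rule: rel.induct)
  case base
  then show ?case using h rel.base by blast
next
  case (step x x' i y y')
  then have al: "set x \<subseteq> alphB n" "set x' \<subseteq> alphB n" "set y \<subseteq> alphB n" "set y' \<subseteq> alphB n"
    using fW_alph[OF n step(2)] by blast+
  show ?case
  proof (cases "i = n")
    case True
    have I: "n \<in> {1..Suc n}" "Suc n \<in> {1..Suc n}" using n by auto
    obtain z where z: "fW TypeD (Suc n) n (virW n x) = Some z" "fW TypeD (Suc n) (Suc n) z = Some (virW n y)"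
      using virW_f_top[OF n al(1)] step(3) True by blast
    obtain z' where z': "fW TypeD (Suc n) n (virW n x') = Some z'" "fW TypeD (Suc n) (Suc n) z' = Some (virW n y')"
      using virW_f_top[OF n al(2)] step(4) True by blast
    show ?thesis
      using rel.step[OF rel.step[OF _ I(1) z(1) z'(1)] I(2) z(2) z'(2)] step.IH al(3,4) by blast
  next
    case False
    then have i: "1 \<le> i" "i < n" "i \<in> {1..Suc n}" using step(2) by auto
    obtain z where z: "fW TypeD (Suc n) i (virW n x) = Some z" "fW TypeD (Suc n) i z = Some (virW n y)"
      using virW_f_low[OF i(1,2) al(1)] step(3) by blast
    obtain z' where z': "fW TypeD (Suc n) i (virW n x') = Some z'" "fW TypeD (Suc n) i z' = Some (virW n y')"
      using virW_f_low[OF i(1,2) al(2)] step(4) by blast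
    show ?thesis
      using rel.step[OF rel.step[OF _ i(3) z(1) z'(1)] i(3) z(2) z'(2)] step.IH al(3,4) by blast
  qed
qed

text \<open>\<open>\<epsilon>\<^sub>i\<close> and \<open>\<phi>\<^sub>i\<close> of the image of \<open>w\<close> are determined by those of \<open>w\<close> and conversely;
  the node \<open>n\<close> of \<open>B\<^sub>n\<close> unfolds into the two end nodes \<open>n\<close>, \<open>n + 1\<close> of \<open>D\<^sub>n\<^sub>+\<^sub>1\<close>.\<close>
lemma virW_eps_phi:
  assumes n: "2 \<le> n" and k: "k \<in> {1..Suc n}" and w: "set w \<subseteq> alphB n"
  shows "epsW TypeD (Suc n) k (virW n w) = (if k < n then 2 else 1) * epsW TypeB n (min k n) w \<and>
    phiW TypeD (Suc n) k (virW n w) = (if k < n then 2 else 1) * phiW TypeB n (min k n) w"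
proof (cases "k < n")
  case True
  then show ?thesis using virW_low[of k n w] k w by (simp add: min_def)
next
  case False
  then have "k \<in> {n, Suc n}" using k by auto
  then show ?thesis using virW_top[OF n _ w, of k] False by (auto simp: min_def)
qed

lemma highest_virW:
  assumes n: "2 \<le> n" and w: "set w \<subseteq> alphB n" "highestJ TypeB n {1..n} w"
  shows "highestJ TypeD (Suc n) {1..Suc n} (virW n w)"
  unfolding highestJ_def
proof
  fix k assume k: "k \<in> {1..Suc n}"
  then have "min k n \<in> {1..n}" using n by auto
  then show "epsW TypeD (Suc n) k (virW n w) = 0"
    using virW_eps_phi[OF n k w(1)] w(2) unfolding highestJ_def by simp
qed

text \<open>The doubled words are matched in D_{n+1} by the simply laced case. It remains to return
  to type B, as the relation there also contains pairs that are not images.\<close>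

lemma matched_B:
  assumes n: "2 \<le> n" and al: "set h \<subseteq> alphB n" "set h' \<subseteq> alphB n"
    and h: "highestJ TypeB n {1..n} h" "highestJ TypeB n {1..n} h'"
    and phi: "\<And>i. i \<in> {1..n} \<Longrightarrow> phiW TypeB n i h = phiW TypeB n i h'"
  shows "matched TypeB n h h'"
proof -
  let ?R = "rel TypeD (Suc n) (virW n h) (virW n h')"
  have n': "2 \<le> Suc n" using n by simp
  have m: "matched TypeD (Suc n) (virW n h) (virW n h')"
  proof (rule matched_D[OF n' highest_virW[OF n al(1) h(1)] highest_virW[OF n al(2) h(2)]])
    fix k assume k: "k \<in> {1..Suc n}"
    then have "min k n \<in> {1..n}" using n by auto
    then show "phiW TypeD (Suc n) k (virW n h) = phiW TypeD (Suc n) k (virW n h')"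
      using virW_eps_phi[OF n k al(1)] virW_eps_phi[OF n k al(2)] phi by simp
  qed
  have same: "epsW TypeB n i x = epsW TypeB n i x' \<and> phiW TypeB n i x = phiW TypeB n i x'"
    if "(virW n x, virW n x') \<in> ?R" "set x \<subseteq> alphB n" "set x' \<subseteq> alphB n" "i \<in> {1..n}" for x x' i
  proof -
    have i: "i \<in> {1..Suc n}" using that(4) by simp
    show ?thesis
      using matchedD(3)[OF m that(1) i] virW_eps_phi[OF n i that(2)] virW_eps_phi[OF n i that(3)] that(4)
      by (simp add: min_def split: if_split_asm)
  qed
  \<comment> \<open>One raising step of type B is two raising steps of the images; the intermediate
    words \<open>z\<close> and \<open>z'\<close> need not be images themselves.\<close>
  have up: "(virW n r, virW n r') \<in> ?R"
    if R: "(virW n x, virW n x') \<in> ?R" and al': "set r \<subseteq> alphB n" "set r' \<subseteq> alphB n"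
      and i: "i \<in> {1..n}" and f: "fW TypeB n i r = Some x" "fW TypeB n i r' = Some x'" for x x' r r' i
  proof -
    have "\<exists>k l. k \<in> {1..Suc n} \<and> l \<in> {1..Suc n} \<and>
      (\<forall>w w'. set w \<subseteq> alphB n \<longrightarrow> fW TypeB n i w = Some w' \<longrightarrow>
        (\<exists>z. fW TypeD (Suc n) k (virW n w) = Some z \<and> fW TypeD (Suc n) l z = Some (virW n w')))"
    proof (cases "i = n")
      case True
      then show ?thesis
        using virW_f_top[OF n] n by (intro exI[of _ n] exI[of _ "Suc n"]) auto
    next
      case False
      then have "1 \<le> i" "i < n" using i by auto
      then show ?thesis
        using virW_f_low[of i n] by (intro exI[of _ i]) auto
    qed
    then obtain k l z z' where kl: "k \<in> {1..Suc n}" "l \<in> {1..Suc n}"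
      and z: "fW TypeD (Suc n) k (virW n r) = Some z" "fW TypeD (Suc n) l z = Some (virW n x)"
      and z': "fW TypeD (Suc n) k (virW n r') = Some z'" "fW TypeD (Suc n) l z' = Some (virW n x')"
      using al' f by metis
    note inv = fW_eq_Some_iff[OF n', of TypeD]
    have "(z, z') \<in> ?R" using matchedD(4)[OF m R kl(2)] z(2) z'(2) inv by blast
    then show ?thesis using matchedD(4)[OF m _ kl(1)] z(1) z'(1) inv by blast
  qed
  \<comment> \<open>Climbing within type B leads to a pair whose images are the two doubled highest
    words; injectivity of the doubling then identifies the pair.\<close>
  have down: "(x, x') \<in> rel TypeB n h h'"
    if "(virW n x, virW n x') \<in> ?R" "set x \<subseteq> alphB n" "set x' \<subseteq> alphB n" for x x'
    using that
  proof (induction "height n x" arbitrary: x x' rule: less_induct)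
    case less
    show ?case
    proof (cases "highestJ TypeB n {1..n} x")
      case True
      then have "virW n x = virW n h \<and> virW n x' = virW n h'"
        using rel_highest[OF n' less(2)] highest_virW[OF n less(3)] by blast
      then show ?thesis using virW_inj rel.base by metis
    next
      case False
      then obtain i r where r: "i \<in> {1..n}" "eW TypeB n i x = Some r" "fW TypeB n i r = Some x" "height n r < height n x"
        using not_highestE[OF _ n] by (metis subset_refl)
      have "epsW TypeB n i x' \<noteq> 0"
        using same[OF less(2-4) r(1)] r(2) eW_eq_None_iff[OF n, of TypeB i x] by auto
      then obtain r' where "eW TypeB n i x' = Some r'" using eW_eq_None_iff[OF n, of TypeB i x'] by auto
      then have r': "fW TypeB n i r' = Some x'" by (simp add: fW_eq_Some_iff[OF n])
      have al': "set r \<subseteq> alphB n" "set r' \<subseteq> alphB n"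
        using fW_alph[OF n r(1)] r(3) r' less(3,4) by blast+
      have "(r, r') \<in> rel TypeB n h h'"
        using less(1)[OF r(4) up[OF less(2) al' r(1,3) r'] al'] .
      then show ?thesis using rel.step[OF _ r(1,3) r'] by blast
    qed
  qed
  have "ok_pair TypeB n (rel TypeB n h h') x x'" if "(x, x') \<in> rel TypeB n h h'" for x x'
    unfolding ok_pair_def
  proof (intro ballI conjI allI impI)
    fix i assume i: "i \<in> {1..n}"
    note x = rel_virW[OF n al that]
    then show "epsW TypeB n i x = epsW TypeB n i x'" "phiW TypeB n i x = phiW TypeB n i x'"
      using same i by blast+
    fix y y' assume "eW TypeB n i x = Some y" "eW TypeB n i x' = Some y'"
    then have f: "fW TypeB n i y = Some x" "fW TypeB n i y' = Some x'" by (simp_all add: fW_eq_Some_iff[OF n])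
    then have "set y \<subseteq> alphB n" "set y' \<subseteq> alphB n" using fW_alph[OF n i] x by blast+
    then show "(y, y') \<in> rel TypeB n h h'" using up[OF _ _ _ i f] down x by blast
  qed
  then show ?thesis using h by (auto simp: matched_def)
qed


section \<open>Recording sequences determine components\<close>

lemma fseq_conn:
  "set is \<subseteq> J \<Longrightarrow> fseq t n is h = Some x \<Longrightarrow> (h, x) \<in> conn t n J"
proof (induction "is" arbitrary: x)
  case (Cons i "is")
  then obtain y where "fseq t n is h = Some y" "fW t n i y = Some x"
    by (auto simp: bind_eq_Some_conv)
  with Cons conn_fW[of i J t n y x] show ?case using conn_trans by (metis insert_subset list.simps(15))
qed simp

lemma comp_self [simp]: "w \<in> comp t n w"
  by (simp add: comp_conn)

lemma comp_fW: "x \<in> comp t n h \<Longrightarrow> i \<in> {1..n} \<Longrightarrow> fW t n i x = Some y \<Longrightarrow> y \<in> comp t n h"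
  using conn_fW conn_trans unfolding comp_conn by fast

lemma comp_iso_fseq:
  assumes "comp_iso t n g h1 h2" "set is \<subseteq> {1..n}" "fseq t n is h1 = Some x"
  shows "x \<in> comp t n h1 \<and> fseq t n is (g h1) = Some (g x)"
  using assms(2,3)
proof (induction "is" arbitrary: x)
  case (Cons i "is")
  then obtain y where y: "fseq t n is h1 = Some y" "fW t n i y = Some x"
    by (auto simp: bind_eq_Some_conv)
  have i: "i \<in> {1..n}" and sub: "set is \<subseteq> {1..n}" using Cons.prems(1) by auto
  note IH = Cons.IH[OF sub y(1)]
  then have "map_option g (fW t n i y) = fW t n i (g y)"
    using assms(1) i unfolding comp_iso_def by blast
  then have "fW t n i (g y) = Some (g x)" using y(2) by simp
  then show ?case using IH comp_fW[OF _ i y(2)] by simp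
qed simp

text \<open>An isomorphism is only required to commute with lowering; \<phi> is preserved because it
  counts the steps until lowering fails. This makes the arbitrary isomorphism inside
  \<open>csim\<close> usable.\<close>

lemma comp_iso_phi:
  assumes n: "2 \<le> n" and g: "comp_iso t n g h1 h2" and i: "i \<in> {1..n}"
  shows "x \<in> comp t n h1 \<Longrightarrow> phiW t n i (g x) = phiW t n i x"
proof (induction "phiW t n i x" arbitrary: x)
  case 0
  have "map_option g (fW t n i x) = fW t n i (g x)"
    using g i 0(2) unfolding comp_iso_def by blast
  then show ?case using 0(1) fW_eq_None_iff[OF n, of t i x] fW_eq_None_iff[OF n, of t i "g x"] by simp
next
  case (Suc m)
  then obtain y where y: "fW t n i x = Some y" using fW_eq_None_iff[OF n, of t i x] by auto
  have "map_option g (fW t n i x) = fW t n i (g x)"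
    using g i Suc(3) unfolding comp_iso_def by blast
  then have gy: "fW t n i (g x) = Some (g y)" using y by simp
  have "phiW t n i y = m" using fW_Some_phiW_epsW[OF n y] Suc(2) by simp
  then have "phiW t n i (g y) = phiW t n i y" using Suc(1) comp_fW[OF Suc(3) i y] by blast
  then show ?case using fW_Some_phiW_epsW[OF n y] fW_Some_phiW_epsW[OF n gy] by simp
qed

lemma pairing_nondegenerate:
  assumes n: "2 \<le> n" and eq: "\<And>i. i \<in> {1..n} \<Longrightarrow> pairing t n i \<mu> = pairing t n i \<nu>" and k: "k \<in> {1..n}"
  shows "\<mu> k = \<nu> k"
proof -
  obtain m where m: "n = Suc (Suc m)"
    using n by (metis add_2_eq_Suc le_Suc_ex)
  have low: "\<mu> i - \<mu> (Suc i) = \<nu> i - \<nu> (Suc i)" if "1 \<le> i" "i < n" for i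
    using eq[of i] that by (simp add: pairing_def)
  \<comment> \<open>In type B the last coroot reads off this coordinate; in type D it is half the
    difference of the last two pairings. The other coordinates follow downwards from successive
    differences.\<close>
  have "\<mu> n = \<nu> n"
    using eq[of n] low[of "Suc m"] m by (cases t) (auto simp: pairing_def)
  have "k \<le> n" using k by simp
  then show ?thesis
  proof (induction rule: inc_induct)
    case base
    show ?case by fact
  next
    case (step j)
    then show ?case using low[of j] k by simp
  qed
qed

lemma highest_wt_phi:
  assumes n: "2 \<le> n" and h: "highestJ t n {1..n} h" "highestJ t n {1..n} h'"
  shows "(\<forall>i\<in>{1..n}. phiW t n i h = phiW t n i h') \<longleftrightarrow> (\<forall>k\<in>{1..n}. wt h k = wt h' k)"
proof -
  have phi: "int (phiW t n i h) = pairing t n i (wt h)" "int (phiW t n i h') = pairing t n i (wt h')"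
    if "i \<in> {1..n}" for i
    using pairing_wt[OF n that, of t h] pairing_wt[OF n that, of t h'] h that unfolding highestJ_def by auto
  show ?thesis
  proof
    assume *: "\<forall>i\<in>{1..n}. phiW t n i h = phiW t n i h'"
    have "pairing t n i (wt h) = pairing t n i (wt h')" if "i \<in> {1..n}" for i
      using phi[OF that] * that by simp
    from pairing_nondegenerate[OF n this] show "\<forall>k\<in>{1..n}. wt h k = wt h' k" by blast
  next
    assume wt: "\<forall>k\<in>{1..n}. wt h k = wt h' k"
    have "pairing t n i (wt h) = pairing t n i (wt h')" if "i \<in> {1..n}" for i
      using wt[rule_format, of i] wt[rule_format, of "Suc i"] wt[rule_format, of "n - 1"]
        wt[rule_format, of n] that n by (simp add: pairing_def)
    then show "\<forall>i\<in>{1..n}. phiW t n i h = phiW t n i h'" using phi by (metis of_nat_eq_iff)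
  qed
qed

text \<open>Collects what differs between the types. A shape \<open>S\<close> stands for a highest
  weight, realised by the word \<open>top S\<close>; weights are compared only at the coordinates 1,
  ..., n. For type D the shape includes the sign.\<close>

locale tableaux =
  fixes t :: ctype and n :: nat and A :: "letter set"
    and valid :: "'s \<Rightarrow> bool" and top :: "'s \<Rightarrow> letter list" and orth :: "'s \<Rightarrow> letter list list \<Rightarrow> bool"
  assumes n: "2 \<le> n"
    and alph_closed: "i \<in> {1..n} \<Longrightarrow> fW t n i w = Some w' \<Longrightarrow> set w \<subseteq> A \<longleftrightarrow> set w' \<subseteq> A"
    and matched: "set h \<subseteq> A \<Longrightarrow> set h' \<subseteq> A \<Longrightarrow> highestJ t n {1..n} h \<Longrightarrow> highestJ t n {1..n} h' \<Longrightarrow>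
      (\<And>i. i \<in> {1..n} \<Longrightarrow> phiW t n i h = phiW t n i h') \<Longrightarrow> matched t n h h'"
    and top: "valid S \<Longrightarrow> set (top S) \<subseteq> A \<and> highestJ t n {1..n} (top S)"
    and orth_comp: "orth S T \<Longrightarrow> valid S \<and> readT T \<in> comp t n (top S)"
    and orth_exists: "valid S \<Longrightarrow> w \<in> comp t n (top S) \<Longrightarrow> \<exists>T. orth S T \<and> readT T = w"
    and orth_inj: "orth S T \<Longrightarrow> orth S T' \<Longrightarrow> readT T = readT T' \<Longrightarrow> T = T'"
    and top_inj: "valid S \<Longrightarrow> valid S' \<Longrightarrow> \<forall>k\<in>{1..n}. wt (top S) k = wt (top S') k \<Longrightarrow> S = S'"
    and wt_inj_alph: "x \<in> A \<Longrightarrow> y \<in> A \<Longrightarrow> (\<And>i. i \<in> {1..n} \<Longrightarrow> wtL x i = wtL y i) \<Longrightarrow> x = y"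
    and dominant: "set h \<subseteq> A \<Longrightarrow> highestJ t n {1..n} h \<Longrightarrow>
      \<exists>S. valid S \<and> (\<forall>k\<in>{1..n}. wt (top S) k = wt h k)"
begin

definition P :: "letter list \<Rightarrow> letter list list" where
  "P w = (THE T. (\<exists>S. orth S T) \<and> csim t n (readT T) w)"

definition shape :: "letter list list \<Rightarrow> 's" where
  "shape T = (THE S. orth S T)"

definition Q :: "letter list \<Rightarrow> 's list" where
  "Q w = map (\<lambda>k. shape (P (take k w))) [1..<length w + 1]"

lemma conn_alph:
  assumes "(a, b) \<in> conn t n {1..n}"
  shows "set a \<subseteq> A \<longleftrightarrow> set b \<subseteq> A"
  using assms n
proof (induction rule: conn_induct)
  case (f i x y)
  then show ?case using alph_closed by metis
next
  case (e i x y)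
  then show ?case using alph_closed fW_eq_Some_iff[OF n] by metis
qed simp

lemma highest_conn_unique:
  assumes "set w \<subseteq> A" "highestJ t n {1..n} h" "(h, w) \<in> conn t n {1..n}"
    "highestJ t n {1..n} h'" "(h', w) \<in> conn t n {1..n}"
  shows "h' = h"
proof (rule highest_unique[OF n])
  have "set h \<subseteq> A" using conn_alph assms(1,3) by blast
  then show "matched t n h h" using assms(2) by (intro matched) auto
  show "(h, h') \<in> conn t n {1..n}" using assms(3,5) conn_sym conn_trans by blast
qed (rule assms(4))

lemma orth_wt:
  assumes w: "set w \<subseteq> A" and h: "highestJ t n {1..n} h" "(h, w) \<in> conn t n {1..n}"
    and T: "orth S T" "csim t n (readT T) w"
  obtains g where "comp_iso t n g (top S) h" "g (top S) = h" "readT T \<in> comp t n (top S)" "g (readT T) = w"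
    "\<forall>k\<in>{1..n}. wt (top S) k = wt h k"
proof -
  obtain h1 h2 g "is" where c: "highestJ t n {1..n} h1" "highestJ t n {1..n} h2" "comp_iso t n g h1 h2"
    "g h1 = h2" "set is \<subseteq> {1..n}" "fseq t n is h1 = Some (readT T)" "fseq t n is h2 = Some w"
    using T(2) unfolding csim_def highest_iff[OF n] by blast
  have S: "set (top S) \<subseteq> A" "highestJ t n {1..n} (top S)" "(top S, readT T) \<in> conn t n {1..n}"
    using orth_comp[OF T(1)] top unfolding comp_conn by blast+
  have "set (readT T) \<subseteq> A" using conn_alph S by blast
  then have h1: "h1 = top S" using highest_conn_unique S(2,3) c(1) fseq_conn[OF c(5,6)] by metis
  have h2: "h2 = h" using highest_conn_unique[OF w h c(2)] fseq_conn[OF c(5,7)] by blast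
  note iso = c(3)[unfolded h1 h2]
  have "phiW t n i (top S) = phiW t n i h" if "i \<in> {1..n}" for i
    using comp_iso_phi[OF n iso that comp_self] c(4) h1 h2 by simp
  then have "\<forall>k\<in>{1..n}. wt (top S) k = wt h k" using highest_wt_phi[OF n S(2) h(1)] by blast
  moreover have "readT T \<in> comp t n (top S)" "g (readT T) = w"
    using comp_iso_fseq[OF c(3,5,6)] c(4,7) h1 by auto
  ultimately show ?thesis using that iso c(4) h1 h2 by blast
qed

lemma orth_csim_exists:
  assumes w: "set w \<subseteq> A" and h: "highestJ t n {1..n} h" "(h, w) \<in> conn t n {1..n}"
  shows "\<exists>S T. orth S T \<and> csim t n (readT T) w"
proof -
  have hA: "set h \<subseteq> A" using conn_alph h(2) w by blast
  then obtain S where S: "valid S" "\<forall>k\<in>{1..n}. wt (top S) k = wt h k" using dominant h(1) by blast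
  note topS = top[OF S(1)]
  have m: "matched t n (top S) h"
    using topS hA h(1) S(2) highest_wt_phi[OF n _ h(1)] by (intro matched) blast+
  obtain x where "(w, x) \<in> rel t n h (top S)" using matched_total[OF n matched_swap[OF m] h(2)] by blast
  then have x: "(x, w) \<in> rel t n (top S) h" by (rule rel_swap)
  then have "x \<in> comp t n (top S)" using rel_conn unfolding comp_conn by blast
  then obtain T where T: "orth S T" "readT T = x" using orth_exists S(1) by blast
  obtain g where "comp_iso t n g (top S) h" "g (top S) = h" using matched_comp_iso[OF n m] by metis
  then have "csim t n x w"
    using rel_fseq[OF x] topS h(1) unfolding csim_def highest_iff[OF n] by blast
  then show ?thesis using T by blast
qed

text \<open>Equal weights force equal shapes, so both tableaux lie in the component of one highest
  word and are compared through a single isomorphism.\<close>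

lemma orth_csim_unique:
  assumes w: "set w \<subseteq> A" and T: "orth S T" "csim t n (readT T) w" "orth S' T'" "csim t n (readT T') w"
  shows "S = S' \<and> T = T'"
proof -
  obtain h where h: "highestJ t n {1..n} h" "(h, w) \<in> conn t n {1..n}" using highest_exists[OF n] by blast
  obtain g where g: "comp_iso t n g (top S) h" "g (top S) = h" "readT T \<in> comp t n (top S)"
    "g (readT T) = w" "\<forall>k\<in>{1..n}. wt (top S) k = wt h k"
    using orth_wt[OF w h T(1,2)] by blast
  obtain "\<forall>k\<in>{1..n}. wt (top S') k = wt h k"
    using orth_wt[OF w h T(3,4)] by blast
  then have S: "S = S'" using top_inj orth_comp T(1,3) g(5) by metis
  obtain h1 h2 g' "is" where c: "highestJ t n {1..n} h1" "highestJ t n {1..n} h2" "comp_iso t n g' h1 h2"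
    "g' h1 = h2" "set is \<subseteq> {1..n}" "fseq t n is h1 = Some (readT T')" "fseq t n is h2 = Some w"
    using T(4) unfolding csim_def highest_iff[OF n] by blast
  have S': "set (top S) \<subseteq> A" "highestJ t n {1..n} (top S)" "(top S, readT T') \<in> conn t n {1..n}"
    using orth_comp[OF T(3)] top S unfolding comp_conn by blast+
  have "set (readT T') \<subseteq> A" using conn_alph S' by blast
  then have h1: "h1 = top S" using highest_conn_unique S'(2,3) c(1) fseq_conn[OF c(5,6)] by metis
  have h2: "h2 = h" using highest_conn_unique[OF w h c(2)] fseq_conn[OF c(5,7)] by blast
  \<comment> \<open>The path to \<open>T'\<close> is transported by the isomorphism \<open>g\<close>
    belonging to \<open>T\<close>, not by \<open>g'\<close>; both tableaux then have the image
    \<open>w\<close>, and injectivity of \<open>g\<close> applies.\<close>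
  have "readT T' \<in> comp t n (top S)" "g (readT T') = w"
    using comp_iso_fseq[OF g(1) c(5)] c(6,7) g(2) unfolding h1 h2 by auto
  then have "readT T = readT T'"
    using g(1,3,4) unfolding comp_iso_def bij_betw_def inj_on_def by blast
  then show ?thesis using orth_inj T(1,3) S by blast
qed

lemma shape_P:
  assumes w: "set w \<subseteq> A" and h: "highestJ t n {1..n} h" "(h, w) \<in> conn t n {1..n}"
  shows "valid (shape (P w))" and "\<forall>k\<in>{1..n}. wt (top (shape (P w))) k = wt h k"
    and "orth (shape (P w)) (P w)"
proof -
  obtain S T where T: "orth S T" "csim t n (readT T) w" using orth_csim_exists[OF w h] by blast
  then have P: "P w = T" unfolding P_def using orth_csim_unique[OF w] by blast
  have S: "shape T = S" unfolding shape_def using T orth_csim_unique[OF w] by blast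
  show "valid (shape (P w))" using orth_comp[OF T(1)] P S by simp
  show "\<forall>k\<in>{1..n}. wt (top (shape (P w))) k = wt h k"
    using orth_wt[OF w h T] unfolding P S by blast
  show "orth (shape (P w)) (P w)" using T(1) P S by simp
qed

lemma Q_length: "length (Q w) = length w"
  by (simp add: Q_def del: upt_Suc)

lemma Q_snoc: "Q (u @ [x]) = Q u @ [shape (P (u @ [x]))]"
  by (auto simp: Q_def)

lemma comp_imp_Q:
  assumes w: "set w1 \<subseteq> A" and c: "(w1, w2) \<in> conn t n {1..n}"
  shows "Q w1 = Q w2"
proof -
  have "shape (P (take k w1)) = shape (P (take k w2))" for k
  proof -
    have ck: "(take k w1, take k w2) \<in> conn t n {1..n}" using conn_prefix[OF n c] by blast
    have k1: "set (take k w1) \<subseteq> A" using w set_take_subset by fast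
    then have k2: "set (take k w2) \<subseteq> A" using conn_alph ck by blast
    obtain h where h: "highestJ t n {1..n} h" "(h, take k w1) \<in> conn t n {1..n}" using highest_exists[OF n] by blast
    note h2 = h(1) conn_trans[OF h(2) ck]
    show ?thesis using shape_P[OF k1 h] shape_P[OF k2 h2] by (intro top_inj) auto
  qed
  then show ?thesis using conn_prefix[OF n c] by (simp add: Q_def)
qed

lemma Q_imp_comp: "set w1 \<subseteq> A \<Longrightarrow> set w2 \<subseteq> A \<Longrightarrow> Q w1 = Q w2 \<Longrightarrow> (w1, w2) \<in> conn t n {1..n}"
proof (induction w1 arbitrary: w2 rule: rev_induct)
  case Nil
  have "length w2 = 0" using arg_cong[OF Nil(3), of length] by (simp only: Q_length list.size(3))
  then show ?case by simp
next
  case (snoc x u)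
  have "length w2 = Suc (length u)" using arg_cong[OF snoc(4), of length] by (simp add: Q_length)
  then obtain v y where w2: "w2 = v @ [y]" by (metis length_0_conv nat.distinct(1) rev_exhaust)
  then have Q: "Q u = Q v" "shape (P (u @ [x])) = shape (P (v @ [y]))" using snoc(4) by (simp_all add: Q_snoc)
  have uv: "(u, v) \<in> conn t n {1..n}" using snoc(1)[OF _ _ Q(1)] snoc(2,3) w2 by simp
  obtain h where h: "highestJ t n {1..n} h" "(h, u @ [x]) \<in> conn t n {1..n}" using highest_exists[OF n] by blast
  obtain k where k: "highestJ t n {1..n} k" "(k, v @ [y]) \<in> conn t n {1..n}" using highest_exists[OF n] by blast
  have "length h = Suc (length u)" "length k = Suc (length v)"
    using conn_prefix[OF n h(2)] conn_prefix[OF n k(2)] by simp_all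
  then obtain h' x' k' y' where hk: "h = h' @ [x']" "k = k' @ [y']" "length h' = length u" "length k' = length v"
    by (metis length_append_singleton length_0_conv nat.distinct(1) nat.inject rev_exhaust)
  have h': "(h', u) \<in> conn t n {1..n}" "highestJ t n {1..n} h'"
    using conn_prefix[OF n h(2), of "length u"] hk highest_prefix h(1) by auto
  have k': "(k', v) \<in> conn t n {1..n}" "highestJ t n {1..n} k'"
    using conn_prefix[OF n k(2), of "length v"] hk highest_prefix k(1) by auto
  have "h' = k'"
    using highest_conn_unique[OF _ k'(2,1) h'(2)] conn_trans[OF h'(1) uv] snoc(3) w2 by simp
  have wt_eq: "wt h i = wt k i" if "i \<in> {1..n}" for i
    using shape_P(2)[OF snoc(2) h] shape_P(2)[of "v @ [y]", OF _ k] Q(2) snoc(3) w2 that by metis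
  have "wtL x' i = wtL y' i" if "i \<in> {1..n}" for i
    using wt_eq[OF that] hk \<open>h' = k'\<close> by simp
  moreover have "x' \<in> A" "y' \<in> A"
    using conn_alph[OF h(2)] conn_alph[OF k(2)] snoc(2,3) w2 hk by auto
  ultimately have "x' = y'" using wt_inj_alph by blast
  then have "h = k" using hk \<open>h' = k'\<close> by simp
  then show ?case using h(2) k(2) conn_sym conn_trans w2 by blast
qed

theorem comp_iff_Q: "set w1 \<subseteq> A \<Longrightarrow> set w2 \<subseteq> A \<Longrightarrow> w2 \<in> comp t n w1 \<longleftrightarrow> Q w1 = Q w2"
  using comp_imp_Q Q_imp_comp unfolding comp_conn by blast

end


section \<open>Shapes and highest tableaux\<close>

text \<open>The length of row \<open>k\<close> of the diagram, that is, the conjugate of the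
  partition of column heights; it is the k-th coordinate of the weight of
  \<open>T\<^sub>Y\<close>.\<close>

definition heights_ge :: "nat list \<Rightarrow> nat \<Rightarrow> nat" where
  "heights_ge Y k = length (filter (\<lambda>c. k \<le> c) Y)"

lemma heights_ge_Nil [simp]: "heights_ge [] k = 0"
  and heights_ge_Cons [simp]: "heights_ge (c # Y) k = (if k \<le> c then 1 else 0) + heights_ge Y k"
  and heights_ge_append [simp]: "heights_ge (Y @ Z) k = heights_ge Y k + heights_ge Z k"
  and heights_ge_replicate [simp]: "heights_ge (replicate m c) k = (if k \<le> c then m else 0)"
  by (simp_all add: heights_ge_def)

lemma count_heights: "count (mset Y) k + heights_ge Y (Suc k) = heights_ge Y k"
  by (induction Y) auto

lemma heights_ge_pos: "0 < heights_ge Y k \<longleftrightarrow> (\<exists>c\<in>set Y. k \<le> c)"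
  by (induction Y) auto

lemma valid_shape_heights_top: "valid_shape n Y \<Longrightarrow> n \<in> set Y \<longleftrightarrow> 0 < heights_ge Y n"
  unfolding heights_ge_pos valid_shape_def by (metis order_antisym order_refl)

lemma valid_shape_eqI:
  assumes Y: "valid_shape n Y" "valid_shape n Z" and eq: "\<forall>k\<in>{1..n}. heights_ge Y k = heights_ge Z k"
  shows "Y = Z"
proof -
  have out: "heights_ge X k = 0" if "valid_shape n X" "n < k" for X k
    using that heights_ge_pos[of X k] unfolding valid_shape_def by (metis leD le_trans neq0_conv)
  have eq': "heights_ge Y k = heights_ge Z k" if "1 \<le> k" for k
    using eq out[OF Y(1)] out[OF Y(2)] that by (cases "k \<le> n") auto
  have "count (mset Y) k = count (mset Z) k" for k
  proof (cases "k = 0")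
    case True
    then have "k \<notin> set Y" "k \<notin> set Z" using Y unfolding valid_shape_def by auto
    then show ?thesis by (metis count_mset_0_iff)
  next
    case False
    then show ?thesis
      using eq'[of k] eq'[of "Suc k"] count_heights[of Y k] count_heights[of Z k] by simp
  qed
  then have "mset (rev Y) = mset (rev Z)" by (simp add: multiset_eq_iff)
  moreover have "sorted (rev Y)" "sorted (rev Z)"
    using Y unfolding valid_shape_def sorted_wrt_rev by auto
  ultimately have "rev Y = rev Z" by (metis properties_for_sort)
  then show ?thesis by simp
qed

lemma sorted_wrt_ge_replicate: "sorted_wrt (\<ge>) (replicate m (c :: nat))"
  by (induction m) auto

lemma partition_exists:
  fixes a :: "nat \<Rightarrow> nat"
  assumes "1 \<le> n" and dec: "\<And>k. 1 \<le> k \<Longrightarrow> k < n \<Longrightarrow> a (Suc k) \<le> a k"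
  shows "\<exists>Y. valid_shape n Y \<and> (\<forall>k\<in>{1..n}. heights_ge Y k = a k)"
proof -
  have "\<exists>Y. valid_shape n Y \<and> (\<forall>c\<in>set Y. 1 \<le> c) \<and> (\<forall>k\<in>{1..n}. heights_ge Y k = a k)"
  proof -
    have "\<exists>Y. valid_shape n Y \<and> (\<forall>c\<in>set Y. m \<le> c) \<and> (\<forall>k\<in>{m..n}. heights_ge Y k = a k)" if "1 \<le> m" "m \<le> n" for m
      using that(2,1)
    proof (induction m rule: inc_induct)
      case base
      show ?case using assms(1)
        by (intro exI[of _ "replicate (a n) n"]) (auto simp: valid_shape_def sorted_wrt_ge_replicate)
    next
      case (step m)
      then obtain Y where Y: "valid_shape n Y" "\<forall>c\<in>set Y. Suc m \<le> c" "\<forall>k\<in>{Suc m..n}. heights_ge Y k = a k"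
        by auto
      have low: "heights_ge Y m = heights_ge Y (Suc m)"
        using count_heights[of Y m] Y(2) by (metis Suc_n_not_le_n add_0 count_mset_0_iff)
      \<comment> \<open>Working down from the tallest columns, the new columns are the shortest so
        far, so appending them keeps the list decreasing; the multiplicity of height m is the
        difference of two consecutive rows.\<close>
      let ?Z = "Y @ replicate (a m - a (Suc m)) m"
      have "valid_shape n ?Z"
        using Y(1,2) step by (auto simp: valid_shape_def sorted_wrt_append sorted_wrt_ge_replicate Suc_le_eq)
      moreover have "heights_ge ?Z k = a k" if "k \<in> {m..n}" for k
        using Y(3) low that dec[of m] step by (cases "k = m") auto
      moreover have "\<forall>c\<in>set ?Z. m \<le> c" using Y(2) by auto
      ultimately show ?case by blast
    qed
    from this[of 1] assms(1) show ?thesis by simp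
  qed
  then show ?thesis by blast
qed

section \<open>Weights of the distinguished tableaux, and why they are highest\<close>

lemma wt_concat_rev: "wt (concat (rev T)) k = (\<Sum>C\<leftarrow>T. wt C k)"
  by (induction T) auto

lemma wt_column: "1 \<le> k \<Longrightarrow> wt (map Pos [1..<c + 1]) k = (if k \<le> c then 1 else 0)"
  by (induction c) auto

lemma wt_TY: "1 \<le> k \<Longrightarrow> wt (readT (TY Y)) k = int (heights_ge Y k)"
  unfolding readT_def wt_concat_rev TY_def
  by (induction Y) (simp_all add: wt_column[simplified])

lemma wt_column_minus:
  assumes "2 \<le> n" "1 \<le> k" "k \<le> n"
  shows "wt (map Pos [1..<n] @ [Bar n]) k = (if k < n then 1 else - 1)"
  using wt_column[OF assms(2), of "n - 1"] assms by auto

lemma wt_TYm: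
  assumes n: "2 \<le> n" and k: "1 \<le> k" "k \<le> n" and Y: "\<forall>c\<in>set Y. c \<le> n"
  shows "wt (readT (TYm n Y)) k = (if k < n then int (heights_ge Y k) else - int (heights_ge Y k))"
  using Y unfolding readT_def wt_concat_rev TYm_def
proof (induction Y)
  case (Cons c Y)
  have "wt (if c = n then map Pos [1..<n] @ [Bar n] else map Pos [1..<c + 1]) k =
    (if k < n then (if k \<le> c then 1 else 0) else - (if k \<le> c then 1 else 0))"
    using wt_column_minus[OF n k] wt_column[OF k(1), of c] Cons(2) k by auto
  then show ?case using Cons by simp
qed simp

lemma highest_append: "highestJ t n J u \<Longrightarrow> highestJ t n J v \<Longrightarrow> highestJ t n J (u @ v)"
  by (simp add: highestJ_def epsW_append)

lemma highest_concat: "(\<And>C. C \<in> set T \<Longrightarrow> highestJ t n J C) \<Longrightarrow> highestJ t n J (concat T)"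
  by (induction T) (auto simp: highest_append, simp add: highestJ_def)

text \<open>For a highest word \<phi> equals the pairing of its weight with the coroot, so whether a
  letter may be appended can be read off the weight.\<close>

lemma highest_snoc:
  assumes n: "2 \<le> n" and u: "highestJ t n {1..n} u"
    and x: "\<And>i. i \<in> {1..n} \<Longrightarrow> int (epsL t n i x) \<le> pairing t n i (wt u)"
  shows "highestJ t n {1..n} (u @ [x])"
  unfolding highestJ_def
proof
  fix i assume i: "i \<in> {1..n}"
  have "epsW t n i u = 0" using u i by (simp add: highestJ_def)
  moreover have "epsL t n i x \<le> phiW t n i u"
    using pairing_wt[OF n i, of t u] x[OF i] \<open>epsW t n i u = 0\<close> by simp
  ultimately show "epsW t n i (u @ [x]) = 0" by (simp add: epsW_append)
qed

lemma highest_column: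
  assumes n: "2 \<le> n"
  shows "c \<le> n \<Longrightarrow> highestJ t n {1..n} (map Pos [1..<c + 1])"
proof (induction c)
  case 0
  then show ?case by (simp add: highestJ_def)
next
  case (Suc c)
  have "highestJ t n {1..n} (map Pos [1..<c + 1] @ [Pos (Suc c)])"
  proof (rule highest_snoc[OF n])
    fix i assume i: "i \<in> {1..n}"
    then have w: "wt (map Pos [1..<c + 1]) i = (if i \<le> c then 1 else 0)"
      "wt (map Pos [1..<c + 1]) (Suc i) = (if Suc i \<le> c then 1 else 0)"
      "wt (map Pos [1..<c + 1]) (n - 1) = (if n - 1 \<le> c then 1 else 0)"
      using wt_column n by auto
    show "int (epsL t n i (Pos (Suc c))) \<le> pairing t n i (wt (map Pos [1..<c + 1]))"
      using w i Suc(2) by (cases "i < n") (simp_all add: epsL_simps[OF n] pairing_def)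
  qed (use Suc in simp)
  then show ?case by simp
qed

lemma highest_column_minus:
  assumes n: "2 \<le> n"
  shows "highestJ TypeD n {1..n} (map Pos [1..<n] @ [Bar n])"
proof (rule highest_snoc[OF n])
  show "highestJ TypeD n {1..n} (map Pos [1..<n])"
    using highest_column[OF n, of "n - 1"] n by simp
  fix i assume i: "i \<in> {1..n}"
  have w: "wt (map Pos [1..<n]) k = (if k < n then 1 else 0)" if "1 \<le> k" for k
    using wt_column[OF that, of "n - 1"] n by auto
  have "wt (map Pos [1..<n]) i = (if i < n then 1 else 0)"
    "wt (map Pos [1..<n]) (Suc i) = (if Suc i < n then 1 else 0)"
    "wt (map Pos [1..<n]) (n - 1) = 1" "wt (map Pos [1..<n]) n = 0"
    using w[of i] w[of "Suc i"] w[of "n - 1"] w[of n] i n by auto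
  then show "int (epsL TypeD n i (Bar n)) \<le> pairing TypeD n i (wt (map Pos [1..<n]))"
    using i n by (cases "i < n") (simp_all add: epsL_simps[OF n] pairing_def)
qed

section \<open>Columns\<close>

text \<open>Columns are described by a condition on neighbouring letters. The last four assumptions say
  that the condition survives every single application of \<open>f\<^sub>i\<close>, read in either direction,
  which is permitted by the tensor product rule.\<close>
locale column_rule =
  fixes t :: ctype and n :: nat and A :: "letter set" and R :: "letter \<Rightarrow> letter \<Rightarrow> bool"
  assumes n: "2 \<le> n"
    and alph: "i \<in> {1..n} \<Longrightarrow> fL t n i x = Some x' \<Longrightarrow> x \<in> A \<longleftrightarrow> x' \<in> A"
    and left_f: "i \<in> {1..n} \<Longrightarrow> fL t n i x = Some x' \<Longrightarrow> x \<in> A \<Longrightarrow> y \<in> A \<Longrightarrow> R x y \<Longrightarrow>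
      epsL t n i y < phiL t n i x \<Longrightarrow> R x' y"
    and right_f: "i \<in> {1..n} \<Longrightarrow> fL t n i y = Some y' \<Longrightarrow> x \<in> A \<Longrightarrow> y \<in> A \<Longrightarrow> R x y \<Longrightarrow> R x y'"
    and left_e: "i \<in> {1..n} \<Longrightarrow> fL t n i x = Some x' \<Longrightarrow> x \<in> A \<Longrightarrow> y \<in> A \<Longrightarrow> R x' y \<Longrightarrow> R x y"
    and right_e: "i \<in> {1..n} \<Longrightarrow> fL t n i y = Some y' \<Longrightarrow> x \<in> A \<Longrightarrow> y \<in> A \<Longrightarrow> R x y' \<Longrightarrow>
      phiL t n i x \<le> epsL t n i y \<Longrightarrow> R x y"
begin

definition col :: "letter list \<Rightarrow> bool" where
  "col C \<longleftrightarrow> set C \<subseteq> A \<and> successively R C"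

lemma col_Nil [simp]: "col []"
  by (simp add: col_def)

lemma col_Cons: "col (x # v) \<longleftrightarrow> x \<in> A \<and> col v \<and> (v = [] \<or> R x (hd v))"
  by (cases v) (auto simp: col_def)

lemma alph_fW: "i \<in> {1..n} \<Longrightarrow> fW t n i w = Some w' \<Longrightarrow> set w \<subseteq> A \<longleftrightarrow> set w' \<subseteq> A"
proof (induction w arbitrary: w')
  case (Cons x v)
  show ?case
  proof (cases "epsW t n i v < phiL t n i x")
    case True
    with Cons.prems(2) obtain x' where "fL t n i x = Some x'" "w' = x' # v" by auto
    then show ?thesis using alph[OF Cons.prems(1)] by simp
  next
    case False
    with Cons.prems(2) obtain v' where "fW t n i v = Some v'" "w' = x # v'" by auto
    then show ?thesis using Cons.IH[OF Cons.prems(1)] by simp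
  qed
qed simp

lemma col_fW:
  assumes i: "i \<in> {1..n}"
  shows "fW t n i C = Some C' \<Longrightarrow> col C \<longleftrightarrow> col C'"
proof (induction C arbitrary: C')
  case (Cons x v)
  show ?case
  proof (cases "epsW t n i v < phiL t n i x")
    case True
    with Cons.prems obtain x' where x': "fL t n i x = Some x'" "C' = x' # v" by auto
    \<comment> \<open>The \<epsilon> of the first letter is at most that of the whole rest
      \<open>v\<close>, which gives the strict inequality required by \<open>left_f\<close>.\<close>
    have "R x y \<longleftrightarrow> R x' y" if "v = y # u" "x \<in> A" "y \<in> A" for y u
      using left_f[OF i x'(1)] left_e[OF i x'(1)] that True by auto
    then show ?thesis
      using alph[OF i x'(1)] x'(2) by (cases v) (auto simp: col_Cons)
  next
    case False
    with Cons.prems obtain v' where v': "fW t n i v = Some v'" "C' = x # v'" by auto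
    note IH = Cons.IH[OF v'(1)]
    obtain y u where v: "v = y # u" using v'(1) by (cases v) auto
    show ?thesis
    proof (cases "epsW t n i u < phiL t n i y")
      case True
      with v v' obtain y' where y': "fL t n i y = Some y'" "v' = y' # u" by auto
      \<comment> \<open>As \<open>y\<close> is the letter acted on, the \<epsilon> of
        \<open>v\<close> is just that of \<open>y\<close>; not acting on \<open>x\<close> therefore
        means exactly the inequality required by \<open>right_e\<close>.\<close>
      have "R x y \<longleftrightarrow> R x y'" if "x \<in> A" "y \<in> A"
        using right_f[OF i y'(1) that] right_e[OF i y'(1) that] False True v by auto
      then show ?thesis
        using IH v v'(2) y'(2) alph[OF i y'(1)] by (auto simp: col_Cons)
    next
      case False
      with v v' obtain u' where "v' = y # u'" by auto
      then show ?thesis using IH v v'(2) by (auto simp: col_Cons)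
    qed
  qed
qed simp

lemma cols_fW:
  assumes i: "i \<in> {1..n}"
  shows "fW t n i (concat T) = Some w \<Longrightarrow>
    \<exists>T'. w = concat T' \<and> map length T' = map length T \<and> ((\<forall>C\<in>set T. col C) \<longleftrightarrow> (\<forall>C\<in>set T'. col C))"
proof (induction T arbitrary: w)
  case (Cons C T)
  from Cons.prems consider C' where "fW t n i C = Some C'" "w = C' @ concat T"
    | v where "fW t n i (concat T) = Some v" "w = C @ v"
    by (auto simp: fW_append split: if_split_asm)
  then show ?case
  proof cases
    case 1
    then show ?thesis using fW_length[OF 1(1)] col_fW[OF i 1(1)]
      by (intro exI[of _ "C' # T"]) simp
  next
    case 2
    with Cons.IH obtain T' where "v = concat T'" "map length T' = map length T"
      "(\<forall>C\<in>set T. col C) \<longleftrightarrow> (\<forall>C\<in>set T'. col C)" by blast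
    then show ?thesis using 2(2) by (intro exI[of _ "C # T'"]) simp
  qed
qed simp

end


section \<open>Cutting a word into pieces of prescribed lengths\<close>

lemma cut_exists: "length w = sum_list ls \<Longrightarrow> \<exists>T. concat T = w \<and> map length T = ls"
proof (induction ls arbitrary: w)
  case (Cons l ls)
  then have "length (drop l w) = sum_list ls" by simp
  then obtain T where "concat T = drop l w" "map length T = ls"
    using Cons.IH by blast
  then show ?case using Cons.prems by (intro exI[of _ "take l w # T"]) simp
qed simp

lemma cut_unique: "concat T = concat T' \<Longrightarrow> map length T = map length T' \<Longrightarrow> T = T'"
proof (induction T arbitrary: T')
  case (Cons C T)
  then obtain C' T'' where "T' = C' # T''" by (cases T') auto
  with Cons show ?case by auto
qed simp

context column_rule
begin

text \<open>The column condition is invariant along walks, so every word in the component of a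
  tableau cuts into columns of the same heights.\<close>

lemma cols_conn:
  assumes T: "\<forall>C\<in>set T. col C" and c: "(concat T, w) \<in> conn t n {1..n}"
  shows "\<exists>T'. w = concat T' \<and> map length T' = map length T \<and> (\<forall>C\<in>set T'. col C)"
  using c n
proof (induction rule: conn_induct)
  case base
  then show ?case using T by blast
next
  case (f i x y)
  then obtain T' where "x = concat T'" "map length T' = map length T" "\<forall>C\<in>set T'. col C" by blast
  then show ?case using cols_fW[OF f.hyps(2)] f.hyps(3) by metis
next
  case (e i x y)
  then obtain T' where T': "x = concat T'" "map length T' = map length T" "\<forall>C\<in>set T'. col C" by blast
  have y: "fW t n i y = Some x" using e.hyps(3) by (simp add: fW_eq_Some_iff[OF n])
  then have "length y = sum_list (map length T)"
    using fW_length[OF y] T'(1,2) by (simp add: length_concat)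
  then obtain T2 where T2: "concat T2 = y" "map length T2 = map length T" using cut_exists by blast
  obtain T3 where T3: "x = concat T3" "map length T3 = map length T2"
    "(\<forall>C\<in>set T2. col C) \<longleftrightarrow> (\<forall>C\<in>set T3. col C)"
    using cols_fW[OF e.hyps(2)] y T2(1) by metis
  \<comment> \<open>Cuts with the same lengths are unique, so the column condition can be carried
    backwards along a lowering arrow.\<close>
  then have "T3 = T'" using T' T2(2) by (intro cut_unique) simp_all
  then show ?case using T2 T3(3) T'(3) by blast
qed

lemma tableau_exists:
  assumes T: "\<forall>C\<in>set T. col C" and w: "w \<in> comp t n (readT T)"
  shows "\<exists>T'. readT T' = w \<and> map length T' = map length T \<and> (\<forall>C\<in>set T'. col C)"
proof -
  obtain T' where "w = concat T'" "map length T' = map length (rev T)" "\<forall>C\<in>set T'. col C"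
    using cols_conn[of "rev T" w] T w unfolding readT_def comp_conn by auto
  moreover from this have "map length (rev T') = map length T" by (metis rev_map rev_rev_ident)
  ultimately show ?thesis by (intro exI[of _ "rev T'"]) (simp add: readT_def)
qed

end

lemma readT_inj: "map length T = map length T' \<Longrightarrow> readT T = readT T' \<Longrightarrow> T = T'"
  using cut_unique[of "rev T" "rev T'"] by (simp add: readT_def flip: rev_map)

text \<open>The inequalities matter for repeated zeros: \<open>[Zero, Zero]\<close> has \<phi> =
  \<epsilon> = 1 at node n, which excludes the step to \<open>[Bar n, Zero]\<close>, not a
  column.\<close>

lemma column_rule_B:
  assumes n: "2 \<le> n"
  shows "column_rule TypeB n (alphB n) (\<lambda>x y. precB n x y \<or> (x = Zero \<and> y = Zero))"
proof
  show "2 \<le> n" by fact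
  fix i x x' assume i: "i \<in> {1..n}" and x: "fL TypeB n i x = Some x'"
  show "x \<in> alphB n \<longleftrightarrow> x' \<in> alphB n" by (rule fL_alph[OF n i x])
  consider "1 \<le> i" "i < n" | "i = n" using i by force
  note i_cases = this
  fix y assume y: "y \<in> alphB n" and xA: "x \<in> alphB n"
  show "precB n x' y \<or> (x' = Zero \<and> y = Zero)"
    if "precB n x y \<or> (x = Zero \<and> y = Zero)" "epsL TypeB n i y < phiL TypeB n i x"
    using i_cases
  proof cases
    case 1
    then show ?thesis using x that xA y
      by (cases y) (auto simp: letter_low alphB_def split: if_split_asm)
  next
    case 2
    then show ?thesis using x that xA y n
      by (cases y; cases x) (auto simp: phiL_simps epsL_simps alphB_def split: if_split_asm)
  qed
  show "precB n x y \<or> (x = Zero \<and> y = Zero)" if "precB n x' y \<or> (x' = Zero \<and> y = Zero)"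
    using i_cases
  proof cases
    case 1
    then show ?thesis using x that xA y
      by (cases y) (auto simp: letter_low alphB_def split: if_split_asm)
  next
    case 2
    then show ?thesis using x that xA y n
      by (cases y; cases x) (auto simp: alphB_def split: if_split_asm)
  qed
  show "precB n y x' \<or> (y = Zero \<and> x' = Zero)" if "precB n y x \<or> (y = Zero \<and> x = Zero)"
    using i_cases
  proof cases
    case 1
    then show ?thesis using x that xA y
      by (cases y) (auto simp: letter_low alphB_def split: if_split_asm)
  next
    case 2
    then show ?thesis using x that xA y n
      by (cases y; cases x) (auto simp: alphB_def split: if_split_asm)
  qed
  show "precB n y x \<or> (y = Zero \<and> x = Zero)"
    if "precB n y x' \<or> (y = Zero \<and> x' = Zero)" "phiL TypeB n i y \<le> epsL TypeB n i x"
    using i_cases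
  proof cases
    case 1
    then show ?thesis using x that xA y
      by (cases y) (auto simp: letter_low alphB_def split: if_split_asm)
  next
    case 2
    then show ?thesis using x that xA y n
      by (cases y; cases x) (auto simp: phiL_simps epsL_simps alphB_def split: if_split_asm)
  qed
qed

lemma fL_alphD:
  assumes "2 \<le> n" "i \<in> {1..n}" "fL TypeD n i x = Some y"
  shows "x \<in> alphD n \<longleftrightarrow> y \<in> alphD n"
proof -
  obtain m where n: "n = Suc (Suc m)"
    using assms(1) by (metis add_2_eq_Suc le_Suc_ex)
  consider "1 \<le> i" "i < n" | "i = n" using assms(2) by force
  then show ?thesis
    using assms(3) unfolding n by cases (auto simp: letter_low letter_topD alphD_def split: if_split_asm)
qed

lemma column_rule_D:
  assumes n: "2 \<le> n"
  shows "column_rule TypeD n (alphD n) (\<lambda>x y. \<not> preceqD n y x)"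
proof
  show "2 \<le> n" by fact
  obtain m where m: "n = Suc (Suc m)"
    using n by (metis add_2_eq_Suc le_Suc_ex)
  fix i x x' assume i: "i \<in> {1..n}" and x: "fL TypeD n i x = Some x'"
  show "x \<in> alphD n \<longleftrightarrow> x' \<in> alphD n" by (rule fL_alphD[OF n i x])
  have i_cases: "1 \<le> i \<and> i < n \<or> i = n" using i by force
  fix y assume y: "y \<in> alphD n" and xA: "x \<in> alphD n"
  show "\<not> preceqD n y x'" if "\<not> preceqD n y x" "epsL TypeD n i y < phiL TypeD n i x"
    using i_cases x that xA y unfolding m
    by (elim disjE conjE; cases y) (auto simp: letter_low letter_topD alphD_def preceqD_def split: if_split_asm)
  show "\<not> preceqD n y x" if "\<not> preceqD n y x'"
    using i_cases x that xA y unfolding m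
    by (elim disjE conjE; cases y) (auto simp: letter_low letter_topD alphD_def preceqD_def split: if_split_asm)
  show "\<not> preceqD n x' y" if "\<not> preceqD n x y"
    using i_cases x that xA y unfolding m
    by (elim disjE conjE; cases y) (auto simp: letter_low letter_topD alphD_def preceqD_def split: if_split_asm)
  show "\<not> preceqD n x y" if "\<not> preceqD n x' y" "phiL TypeD n i y \<le> epsL TypeD n i x"
    using i_cases x that xA y unfolding m
    by (elim disjE conjE; cases y) (auto simp: letter_low letter_topD alphD_def preceqD_def split: if_split_asm)
qed


section \<open>Orthogonal tableaux\<close>

lemma successively_column:
  assumes "\<And>k. 1 \<le> k \<Longrightarrow> k < c \<Longrightarrow> R (Pos k) (Pos (Suc k))"
  shows "successively R (map Pos [1..<c + 1])"
  using assms by (auto simp: successively_conv_nth nth_append simp del: upt_Suc)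

lemma length_TY [simp]: "map length (TY Y) = Y"
  by (simp add: TY_def o_def del: upt_Suc)

lemma length_TYm [simp]: "1 \<le> n \<Longrightarrow> map length (TYm n Y) = Y"
  by (induction Y) (auto simp: TYm_def)

lemma set_readT: "set (readT T) = (\<Union>C\<in>set T. set C)"
  by (simp add: readT_def)

lemma highest_readT: "(\<And>C. C \<in> set T \<Longrightarrow> highestJ t n J C) \<Longrightarrow> highestJ t n J (readT T)"
  unfolding readT_def by (rule highest_concat) simp

lemma highest_TY:
  assumes "2 \<le> n" "valid_shape n Y"
  shows "highestJ t n {1..n} (readT (TY Y))"
  using highest_column[OF assms(1), of _ t] assms(2)
  by (intro highest_readT) (auto simp: TY_def valid_shape_def simp del: upt_Suc)

lemma highest_TYm:
  assumes "2 \<le> n" "valid_shape n Y"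
  shows "highestJ TypeD n {1..n} (readT (TYm n Y))"
  using highest_column[OF assms(1), of _ TypeD] highest_column_minus[OF assms(1)] assms(2)
  by (intro highest_readT) (auto simp: TYm_def valid_shape_def simp del: upt_Suc)

lemma pairing_highest_nonneg:
  assumes "2 \<le> n" "highestJ t n {1..n} h" "i \<in> {1..n}"
  shows "0 \<le> pairing t n i (wt h)"
  using pairing_wt[OF assms(1,3), of t h] assms(2,3) unfolding highestJ_def
  by (metis diff_zero of_nat_0 of_nat_0_le_iff)

lemma colB_TY: "c \<le> n \<Longrightarrow> colB n (map Pos [1..<c + 1])"
  unfolding colB_def using successively_column[of c "\<lambda>x y. precB n x y \<or> (x = Zero \<and> y = Zero)"]
  by (auto simp: alphB_def simp del: upt_Suc)

lemma colD_TY: "c \<le> n \<Longrightarrow> colD n (map Pos [1..<c + 1])"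
  unfolding colD_def using successively_column[of c "\<lambda>x y. \<not> preceqD n y x"]
  by (auto simp: alphD_def preceqD_def simp del: upt_Suc)

lemma colD_minus:
  assumes "2 \<le> n"
  shows "colD n (map Pos [1..<n] @ [Bar n])"
proof -
  have "successively (\<lambda>x y. \<not> preceqD n y x) (map Pos [1..<n])"
    using successively_column[of "n - 1" "\<lambda>x y. \<not> preceqD n y x"] assms by (auto simp: preceqD_def)
  then show ?thesis
    using assms unfolding colD_def successively_append_iff
    by (auto simp: alphD_def preceqD_def last_map simp del: upt_Suc)
qed

lemma tableaux_B:
  assumes n: "2 \<le> n"
  shows "tableaux TypeB n (alphB n) (valid_shape n) (\<lambda>Y. readT (TY Y)) (orthB n)"
proof
  show "2 \<le> n" by fact
  fix i w w' assume "i \<in> {1..n}" "fW TypeB n i w = Some w'"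
  then show "set w \<subseteq> alphB n \<longleftrightarrow> set w' \<subseteq> alphB n" by (rule fW_alph[OF n])
next
  fix h h' assume "set h \<subseteq> alphB n" "set h' \<subseteq> alphB n" "highestJ TypeB n {1..n} h" "highestJ TypeB n {1..n} h'"
    "\<And>i. i \<in> {1..n} \<Longrightarrow> phiW TypeB n i h = phiW TypeB n i h'"
  then show "matched TypeB n h h'" by (rule matched_B[OF n])
next
  interpret column_rule TypeB n "alphB n" "\<lambda>x y. precB n x y \<or> (x = Zero \<and> y = Zero)"
    by (rule column_rule_B[OF n])
  have col: "col C \<longleftrightarrow> colB n C" for C by (simp add: col_def colB_def)
  have cols: "\<forall>C\<in>set (TY Y). col C" if "valid_shape n Y" for Y
    using that colB_TY[of _ n] unfolding col by (auto simp: TY_def valid_shape_def simp del: upt_Suc)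
  fix Y assume Y: "valid_shape n Y"
  have "set (readT (TY Y)) \<subseteq> alphB n" using cols[OF Y] by (auto simp: set_readT col_def)
  then show "set (readT (TY Y)) \<subseteq> alphB n \<and> highestJ TypeB n {1..n} (readT (TY Y))"
    using highest_TY[OF n Y] by blast
  fix w assume "w \<in> comp TypeB n (readT (TY Y))"
  then show "\<exists>T. orthB n Y T \<and> readT T = w"
    using tableau_exists[OF cols[OF Y], of w] Y unfolding orthB_def col length_TY by blast
next
  fix Y T assume T: "orthB n Y T"
  then show "valid_shape n Y \<and> readT T \<in> comp TypeB n (readT (TY Y))" by (simp add: orthB_def)
  fix T' assume "orthB n Y T'" "readT T = readT T'"
  with T show "T = T'" by (intro readT_inj) (auto simp: orthB_def)
next
  fix Y Y' assume "valid_shape n Y" "valid_shape n Y'" "\<forall>k\<in>{1..n}. wt (readT (TY Y)) k = wt (readT (TY Y')) k"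
  then show "Y = Y'" by (intro valid_shape_eqI) (auto simp: wt_TY)
next
  fix x y assume "x \<in> alphB n" "y \<in> alphB n" and eq: "\<And>i. i \<in> {1..n} \<Longrightarrow> wtL x i = wtL y i"
  then show "x = y"
    using eq[of "case x of Pos i \<Rightarrow> i | Bar i \<Rightarrow> i"] eq[of "case y of Pos i \<Rightarrow> i | Bar i \<Rightarrow> i"]
    by (cases x; cases y) (auto simp: alphB_def split: if_split_asm)
next
  fix h assume h: "highestJ TypeB n {1..n} h"
  note nonneg = pairing_highest_nonneg[OF n h]
  \<comment> \<open>Dominance in type B: the coordinates decrease and the last one is nonnegative,
    so they are the row lengths of a diagram.\<close>
  have top: "0 \<le> wt h n" using nonneg[of n] n by (simp add: pairing_def)
  have dec: "wt h (Suc k) \<le> wt h k" if "1 \<le> k" "k < n" for k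
    using nonneg[of k] that by (simp add: pairing_def)
  have pos: "0 \<le> wt h k" if "1 \<le> k" "k \<le> n" for k
    using that(2,1)
  proof (induction rule: inc_induct)
    case (step m)
    then show ?case using dec[of m] by simp
  qed (rule top)
  obtain Y where Y: "valid_shape n Y" "\<forall>k\<in>{1..n}. heights_ge Y k = nat (wt h k)"
    using partition_exists[of n "\<lambda>k. nat (wt h k)"] dec n by (auto simp: nat_mono)
  then have "\<forall>k\<in>{1..n}. wt (readT (TY Y)) k = wt h k" using pos by (simp add: wt_TY)
  then show "\<exists>Y. valid_shape n Y \<and> (\<forall>k\<in>{1..n}. wt (readT (TY Y)) k = wt h k)" using Y(1) by blast
qed

text \<open>Encodes the convention that the sign is 0 exactly for shapes without a column of height \<open>n\<close>.\<close>
definition validD :: "nat \<Rightarrow> nat list \<times> dsign \<Rightarrow> bool" where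
  "validD n S \<longleftrightarrow> valid_shape n (fst S) \<and> (snd S = DZero \<longleftrightarrow> n \<notin> set (fst S))"

definition topT :: "nat \<Rightarrow> nat list \<times> dsign \<Rightarrow> letter list list" where
  "topT n S = (if snd S = DMinus then TYm n (fst S) else TY (fst S))"

lemma orthD_iff:
  "orthD n S T \<longleftrightarrow> validD n S \<and> map length T = fst S \<and> (\<forall>C\<in>set T. colD n C) \<and>
    readT T \<in> comp TypeD n (readT (topT n S))"
  by (cases "snd S") (auto simp: orthD_def Let_def validD_def topT_def)

lemma wt_topT:
  assumes "2 \<le> n" "validD n S" "k \<in> {1..n}"
  shows "wt (readT (topT n S)) k =
    (if k = n \<and> snd S = DMinus then - int (heights_ge (fst S) k) else int (heights_ge (fst S) k))"
  using assms wt_TYm[OF assms(1), of k "fst S"] wt_TY[of k "fst S"]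
  by (auto simp: topT_def validD_def valid_shape_def)

lemma tableaux_D:
  assumes n: "2 \<le> n"
  shows "tableaux TypeD n (alphD n) (validD n) (\<lambda>S. readT (topT n S)) (orthD n)"
proof
  interpret column_rule TypeD n "alphD n" "\<lambda>x y. \<not> preceqD n y x"
    by (rule column_rule_D[OF n])
  show "2 \<le> n" by fact
  fix i w w' assume "i \<in> {1..n}" "fW TypeD n i w = Some w'"
  then show "set w \<subseteq> alphD n \<longleftrightarrow> set w' \<subseteq> alphD n" by (rule alph_fW)
next
  fix h h' assume "highestJ TypeD n {1..n} h" "highestJ TypeD n {1..n} h'"
    "\<And>i. i \<in> {1..n} \<Longrightarrow> phiW TypeD n i h = phiW TypeD n i h'"
  then show "matched TypeD n h h'" by (rule matched_D[OF n])
next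
  interpret column_rule TypeD n "alphD n" "\<lambda>x y. \<not> preceqD n y x"
    by (rule column_rule_D[OF n])
  have col: "col C \<longleftrightarrow> colD n C" for C by (simp add: col_def colD_def)
  fix S assume S: "validD n S"
  then have Y: "valid_shape n (fst S)" by (simp add: validD_def)
  have cols: "\<forall>C\<in>set (topT n S). col C"
    using Y colD_TY[of _ n] colD_minus[OF n] unfolding col
    by (auto simp: topT_def TY_def TYm_def valid_shape_def simp del: upt_Suc)
  have len: "map length (topT n S) = fst S" using n by (simp add: topT_def)
  have "set (readT (topT n S)) \<subseteq> alphD n" using cols by (auto simp: set_readT col_def)
  then show "set (readT (topT n S)) \<subseteq> alphD n \<and> highestJ TypeD n {1..n} (readT (topT n S))"
    using highest_TY[OF n Y] highest_TYm[OF n Y] by (simp add: topT_def)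
  fix w assume "w \<in> comp TypeD n (readT (topT n S))"
  then show "\<exists>T. orthD n S T \<and> readT T = w"
    using tableau_exists[OF cols, of w] S len unfolding orthD_iff col by auto
next
  fix S T assume T: "orthD n S T"
  then show "validD n S \<and> readT T \<in> comp TypeD n (readT (topT n S))" by (simp add: orthD_iff)
  fix T' assume "orthD n S T'" "readT T = readT T'"
  with T show "T = T'" by (intro readT_inj) (auto simp: orthD_iff)
next
  fix S S' assume S: "validD n S" "validD n S'"
    and eq: "\<forall>k\<in>{1..n}. wt (readT (topT n S)) k = wt (readT (topT n S')) k"
  \<comment> \<open>Up to a sign in the last coordinate the weights are row lengths, so equal
    weights give equal row lengths whatever the signs of the shapes.\<close>
  have h: "heights_ge (fst S) k = heights_ge (fst S') k" if "k \<in> {1..n}" for k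
    using wt_topT[OF n S(1) that] wt_topT[OF n S(2) that] eq that
    by (auto split: if_split_asm)
  then have Y: "fst S = fst S'" using S by (intro valid_shape_eqI) (auto simp: validD_def)
  have n1: "n \<in> {1..n}" using n by simp
  have "snd S = snd S'"
  proof (cases "n \<in> set (fst S)")
    case True
    then have "0 < heights_ge (fst S) n" using S(1) valid_shape_heights_top by (auto simp: validD_def)
    then have "snd S = DMinus \<longleftrightarrow> snd S' = DMinus"
      using wt_topT[OF n S(1) n1] wt_topT[OF n S(2) n1] eq n1 Y by (auto split: if_split_asm)
    moreover have "snd S \<noteq> DZero" "snd S' \<noteq> DZero" using True S Y by (auto simp: validD_def)
    ultimately show ?thesis by (cases "snd S"; cases "snd S'") auto
  next
    case False
    then show ?thesis using S Y by (simp add: validD_def)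
  qed
  with Y show "S = S'" by (simp add: prod_eq_iff)
next
  fix x y assume "x \<in> alphD n" "y \<in> alphD n" and eq: "\<And>i. i \<in> {1..n} \<Longrightarrow> wtL x i = wtL y i"
  then show "x = y"
    using eq[of "case x of Pos i \<Rightarrow> i | Bar i \<Rightarrow> i"] eq[of "case y of Pos i \<Rightarrow> i | Bar i \<Rightarrow> i"]
    by (cases x; cases y) (auto simp: alphD_def split: if_split_asm)
next
  fix h assume h: "highestJ TypeD n {1..n} h"
  note nonneg = pairing_highest_nonneg[OF n h]
  \<comment> \<open>Dominance in type D only bounds the last coordinate in absolute value by the one
    before it. The absolute values still form a partition.\<close>
  define a where "a k = nat \<bar>wt h k\<bar>" for k
  have dec: "wt h (Suc k) \<le> wt h k" if "1 \<le> k" "k < n" for k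
    using nonneg[of k] that by (simp add: pairing_def)
  have "wt h n \<le> wt h (n - 1)" using dec[of "n - 1"] n by simp
  moreover have "0 \<le> wt h (n - 1) + wt h n" using nonneg[of n] n by (simp add: pairing_def)
  ultimately have top: "\<bar>wt h n\<bar> \<le> wt h (n - 1)" by simp
  have pos: "0 \<le> wt h k" if "1 \<le> k" "k < n" for k
  proof -
    have "k \<le> n - 1" using that by simp
    then show ?thesis
    proof (induction rule: inc_induct)
      case base
      show ?case using top by simp
    next
      case (step m)
      then have "wt h (Suc m) \<le> wt h m" using that by (intro dec) auto
      then show ?case using step by simp
    qed
  qed
  have "a (Suc k) \<le> a k" if "1 \<le> k" "k < n" for k
  proof (cases "Suc k = n")
    case True
    then show ?thesis using top by (auto simp: a_def)
  next
    case False
    then show ?thesis using dec[OF that] pos[OF that] pos[of "Suc k"] that by (simp add: a_def)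
  qed
  then obtain Y where Y: "valid_shape n Y" "\<forall>k\<in>{1..n}. heights_ge Y k = a k"
    using partition_exists[of n a] n by auto
  \<comment> \<open>The sign of the last coordinate becomes the sign of the shape; it vanishes
    exactly when no column has height n.\<close>
  define s where "s = (if wt h n < 0 then DMinus else if wt h n = 0 then DZero else DPlus)"
  have "heights_ge Y n = a n" using Y(2) n by simp
  then have v: "validD n (Y, s)"
    using Y(1) valid_shape_heights_top[OF Y(1)] by (auto simp: validD_def s_def a_def)
  have "wt (readT (topT n (Y, s))) k = wt h k" if k: "k \<in> {1..n}" for k
    using wt_topT[OF n v k] Y(2) k pos[of k] by (cases "k = n") (auto simp: s_def a_def)
  then show "\<exists>S. validD n S \<and> (\<forall>k\<in>{1..n}. wt (readT (topT n S)) k = wt h k)" using v by blast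
qed

theorem mainTheorem11:
  fixes n :: nat
  assumes "n \<ge> 2"
  shows "(\<forall>w1 w2. set w1 \<subseteq> alphB n \<longrightarrow> set w2 \<subseteq> alphB n \<longrightarrow>
            (w2 \<in> comp TypeB n w1 \<longleftrightarrow> QB n w1 = QB n w2))
       \<and> (\<forall>w1 w2. set w1 \<subseteq> alphD n \<longrightarrow> set w2 \<subseteq> alphD n \<longrightarrow>
            (w2 \<in> comp TypeD n w1 \<longleftrightarrow> QD n w1 = QD n w2))"
proof -
  interpret B: tableaux TypeB n "alphB n" "valid_shape n" "\<lambda>Y. readT (TY Y)" "orthB n"
    by (rule tableaux_B[OF assms])
  interpret D: tableaux TypeD n "alphD n" "validD n" "\<lambda>S. readT (topT n S)" "orthD n"
    by (rule tableaux_D[OF assms])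
  have P: "B.P = PB n" by (rule ext) (simp add: B.P_def PB_def)
  \<comment> \<open>\<open>QB\<close> reads the shape off the column lengths, \<open>B.Q\<close> off
    the component of the tableau. They agree once the tableau is known to be orthogonal, which is
    where the alphabet enters.\<close>
  have "QB n w = B.Q w" if "set w \<subseteq> alphB n" for w
    unfolding QB_def B.Q_def P
  proof (rule map_cong[OF refl])
    fix k
    have k: "set (take k w) \<subseteq> alphB n" using that set_take_subset by fast
    obtain h where "highestJ TypeB n {1..n} h" "(h, take k w) \<in> conn TypeB n {1..n}"
      using highest_exists[OF assms] by blast
    from B.shape_P(3)[OF k this] show "map length (PB n (take k w)) = B.shape (PB n (take k w))"
      by (simp add: P orthB_def)
  qed
  moreover have "QD n w = D.Q w" for w
    by (simp add: QD_def D.Q_def shapeD_def PD_def D.shape_def D.P_def)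
  ultimately show ?thesis using B.comp_iff_Q D.comp_iff_Q by simp
qed

end
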